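(* Let $A$, $B$, $C$ and $C'$ be matrices in $\mathbb{C}^{d\times d}$, with $C+kI$ and $C'+kI$ invertible for all integers $k\ge0$. Then the Horn matrix function $H_1(A,B,C;C';x,y)$ satisfies the following infinite summation formulae for $|t|<1$: (1) $(1-t)^{-A}\,H_1\!\left(A,B,C;C';\frac{x}{1-t},y(1-t)\right)=\sum_{n=0}^{\infty}\frac{(A)_n}{n!}\,H_1(A+nI,B,C;C';x,y)\,t^n$; (2) if $AB=BA$, $(1-t)^{-B}\,H_1\!\left(A,B,C;C';\frac{x}{1-t},\frac{y}{1-t}\right)=\sum_{n=0}^{\infty}\frac{(B)_n}{n!}\,H_1(A,B+nI,C;C';x,y)\,t^n$; (3) if $CC'=C'C$, $H_1\!\left(A,B,C;C';x,\frac{y}{1-t}\right)(1-t)^{-C}=\sum_{n=0}^{\infty}H_1(A,B,C+nI;C';x,y)\,\frac{(C)_n}{n!}\,t^n$.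
   Context: $H_1(A,B,C;C';x,y)=\sum_{m,n=0}^{\infty}(A)_{m-n}(B)_{m+n}(C)_n(C')_m^{-1}\frac{x^m y^n}{m!\,n!}$. Matrix Pochhammer symbol: for $M\in\mathbb{C}^{d\times d}$, $(M)_0=I$, $(M)_n=M(M+I)\cdots(M+(n-1)I)$ for $n\ge1$, and $(M)_{-n}=(-1)^n(I-M)_n^{-1}$; $(M)_n^{-1}$ is the inverse matrix of $(M)_n$. For $|t|<1$, $(1-t)^{-M}=\sum_{n\ge0}\frac{(M)_n}{n!}t^n$.
   Formalization: The series on the right can diverge for some |t|<1; equality is stated whenever it converges, and convergence when the left H_1 stays in its region for all |s|≤|t|. A-kI (k≥1), and in (1) A+kI, are assumed invertible; every H_1 is taken inside its open region of convergence. *)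

theory Defs
  imports "HOL-Analysis.Analysis"
begin

text \<open>
  Matrices are elements of \<^typ>\<open>complex^'d^'d\<close>, with product \<open>**\<close> and \<open>mat c\<close> for \<open>c I\<close>.
  The type-class operations \<open>*\<close> and \<open>1\<close> on this type are componentwise and are not used.
\<close>

definition mscale :: "complex \<Rightarrow> complex^'d^'d \<Rightarrow> complex^'d^'d" (infixr "*\<^sub>m" 75)
  where "c *\<^sub>m M = (\<chi> i j. c * M $ i $ j)"

primrec mpoch :: "complex^'d^'d \<Rightarrow> nat \<Rightarrow> complex^'d^'d" where
  "mpoch M 0 = mat 1"
| "mpoch M (Suc n) = mpoch M n ** (M + mat (of_nat n))"

text \<open>
  For a negative index this is meaningful only if \<open>M - I, M - 2 I, \<dots>\<close> (as far as they occur)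
  are invertible; \<^const>\<open>matrix_inv\<close> is unspecified otherwise.
\<close>

definition mpoch_int :: "complex^'d^'d \<Rightarrow> int \<Rightarrow> complex^'d^'d" where
  "mpoch_int M k =
     (if k \<ge> 0 then mpoch M (nat k)
      else ((-1) ^ nat (- k)) *\<^sub>m matrix_inv (mpoch (mat 1 - M) (nat (- k))))"

text \<open>\<open>one_minus_powr t M\<close> is \<open>(1 - t)\<close> to the power \<open>-M\<close>, for \<open>norm t < 1\<close>.\<close>

definition one_minus_powr :: "complex \<Rightarrow> complex^'d^'d \<Rightarrow> complex^'d^'d" where
  "one_minus_powr t M = (\<Sum>n. (t ^ n / fact n) *\<^sub>m mpoch M n)"

definition H1_term ::
  "complex^'d^'d \<Rightarrow> complex^'d^'d \<Rightarrow> complex^'d^'d \<Rightarrow> complex^'d^'d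
    \<Rightarrow> complex \<Rightarrow> complex \<Rightarrow> nat \<times> nat \<Rightarrow> complex^'d^'d" where
  "H1_term A B C C' x y = (\<lambda>(m, n).
     (x ^ m * y ^ n / (fact m * fact n)) *\<^sub>m
       (mpoch_int A (int m - int n) ** mpoch B (m + n) ** mpoch C n ** matrix_inv (mpoch C' m)))"

definition H1 ::
  "complex^'d^'d \<Rightarrow> complex^'d^'d \<Rightarrow> complex^'d^'d \<Rightarrow> complex^'d^'d
    \<Rightarrow> complex \<Rightarrow> complex \<Rightarrow> complex^'d^'d" where
  "H1 A B C C' x y = infsum (H1_term A B C C' x y) UNIV"

text \<open>
  The region of convergence of a double power series: the interior of the set of points of
  absolute convergence.  It depends on the matrix parameters (for instance, it is everything if
  the double series terminates).
\<close>

definition H1_region ::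
  "complex^'d^'d \<Rightarrow> complex^'d^'d \<Rightarrow> complex^'d^'d \<Rightarrow> complex^'d^'d \<Rightarrow> (complex \<times> complex) set" where
  "H1_region A B C C' =
     interior {(x, y). (\<lambda>p. norm (H1_term A B C C' x y p)) summable_on UNIV}"

end

theory Submission
  imports Defs "HOL-Complex_Analysis.Complex_Analysis"
begin

text \<open>
  Let \<open>T\<^sub>m\<^sub>k\<close> be the coefficient of \<open>x\<^sup>m y\<^sup>k\<close> in \<open>H\<^sub>1\<close>.  All three formulae are instances of one
  statement.  For \<open>P = A\<close>, \<open>B\<close> or \<open>C\<close>, passing from \<open>P\<close> to \<open>P + n I\<close> and multiplying by \<open>(P)\<^sub>n\<close>
  multiplies \<open>T\<^sub>m\<^sub>k\<close> by \<open>(P + w I)\<^sub>n\<close>, where the integer weight \<open>w\<close> is \<open>m - k\<close>, \<open>m + k\<close> or \<open>k\<close>;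
  this is where the commutation hypotheses enter (lemmas \<open>mpoch_H1_shift_A\<close>, \<open>mpoch_H1_shift_B\<close>,
  \<open>H1_mpoch_shift_C\<close>).  The binomial series gives
  \<open>(\<Sum>n. (t ^ n / fact n) *\<^sub>m mpoch (P + mat w) n) = (1 - t) powi (- w) *\<^sub>m one_minus_powr t P\<close>.
  As \<open>w = - (a m + b k)\<close> is linear in \<open>m\<close> and \<open>k\<close>, the scalar factor is absorbed by replacing
  \<open>(x, y)\<close> with \<open>(x (1 - t) powi a, y (1 - t) powi b)\<close>.  Formally, the formulae follow by
  interchanging two summations.

  In general the interchange is absolutely convergent only for small \<open>t\<close>, whereas equality is claimed
  as soon as \<open>(x, y)\<close> and \<open>(x (1 - t) powi a, y (1 - t) powi b)\<close> lie in the region of convergence and the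
  right-hand side converges.  The gap is bridged by analytic continuation in \<open>s\<close> of
  \<open>F s = one_minus_powr s P ** H1 A B C C' (x (1 - s) powi a) (y (1 - s) powi b)\<close>.
  The norms of the terms of the double series depend on \<open>s\<close> only through \<open>r = norm (1 - s)\<close>, by
  a factor \<open>r powi (- w)\<close>, which is monotone in \<open>r\<close>.  So convergence at two radii implies convergence
  between them, and \<open>F\<close> is holomorphic where the unit disc meets an annulus
  \<open>\<alpha> < norm (1 - s) < \<beta>\<close> that contains both \<open>0\<close> and \<open>t\<close>.
  The right-hand side of each formula is the Taylor series of \<open>F\<close> at \<open>0\<close>, evaluated at \<open>t\<close>.
  If it converges there, then it represents \<open>F\<close> on the intersection of the annulus with
  the disc \<open>norm s < norm t\<close>, because that intersection is connected, and Abel's limit theorem extends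
  the equality to the boundary point \<open>t\<close> (lemma \<open>powser_continuation\<close>).  If the whole closed disc
  of radius \<open>norm t\<close> corresponds to points in the region, then \<open>F\<close> is holomorphic on a larger
  disc and the Taylor series converges at \<open>t\<close>.

  In the third formula the factors stand on the right; it is obtained from
  the transposed double series.
\<close>

section \<open>Boundary values and continuation of power series\<close>

text \<open>
  Summation by parts: with the tails \<open>R n\<close> of the series, the difference of the two sides is
  \<open>(1 - r)\<close> times \<open>\<Sum>n. r ^ n *\<^sub>R R (n + 1)\<close>.  Finitely many tails contribute a multiple of
  \<open>1 - r\<close>; the others are small, and \<open>(1 - r) * (\<Sum>n. r ^ n) = 1\<close>.
\<close>

lemma Abel_limit:
  fixes b :: "nat \<Rightarrow> 'a::banach"
  assumes "b sums S"
  shows "((\<lambda>r. \<Sum>n. r ^ n *\<^sub>R b n) \<longlongrightarrow> S) (at_left 1)"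
proof -
  define R where "R = (\<lambda>n. S - (\<Sum>k<n. b k))"
  have R_lim: "R \<longlonglongrightarrow> 0"
    using assms unfolding R_def sums_def by (auto intro: tendsto_eq_intros)
  then obtain K where K: "\<And>n. norm (R n) \<le> K"
    by (metis Bseq_def convergent_def convergent_imp_Bseq)
  have "0 \<le> K"
    using K norm_ge_zero order_trans by blast
  have summ: "summable (\<lambda>n. norm (r ^ n *\<^sub>R R (n + m)))" if "0 < r" "r < 1" for r :: real and m
  proof (rule summable_comparison_test')
    show "summable (\<lambda>n. K * r ^ n)"
      using that by (intro summable_mult summable_geometric) auto
    show "norm (norm (r ^ n *\<^sub>R R (n + m))) \<le> K * r ^ n" if "n \<ge> 0" for n
      using K[of "n + m"] \<open>0 < r\<close> by (simp add: mult.commute mult_right_mono)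
  qed
  have key: "(\<Sum>n. r ^ n *\<^sub>R b n) - S = (r - 1) *\<^sub>R (\<Sum>n. r ^ n *\<^sub>R R (n + 1))"
    if r: "0 < r" "r < 1" for r
  proof -
    let ?Y = "\<Sum>n. r ^ n *\<^sub>R R (n + 1)"
    have s1: "(\<lambda>n. r ^ n *\<^sub>R R (n + 1)) sums ?Y"
      using summable_norm_cancel[OF summ[OF r, of 1]] by (rule summable_sums)
    have "(\<lambda>n. r ^ Suc n *\<^sub>R R (Suc n)) sums (r *\<^sub>R ?Y)"
      using sums_scaleR_right[OF s1, of r] by simp
    then have s0: "(\<lambda>n. r ^ n *\<^sub>R R n) sums (r *\<^sub>R ?Y + S)"
      by (subst (asm) sums_Suc_iff) (simp add: R_def)
    have b: "b n = R n - R (n + 1)" for n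
      by (simp add: R_def)
    have "(\<lambda>n. r ^ n *\<^sub>R b n) sums (r *\<^sub>R ?Y + S - ?Y)"
      using sums_diff[OF s0 s1] by (simp add: b scaleR_right_diff_distrib)
    then show ?thesis
      by (simp add: sums_iff scaleR_left_diff_distrib)
  qed
  show ?thesis
  proof (rule tendstoI)
    fix e :: real assume e: "0 < e"
    obtain N where N: "\<And>n. n \<ge> N \<Longrightarrow> norm (R n) < e / 2"
      using LIMSEQ_D[OF R_lim, of "e / 2"] e by auto
    define L where "L = (\<Sum>n<N. norm (R (n + 1)))"
    have bound: "norm ((\<Sum>n. r ^ n *\<^sub>R b n) - S) \<le> (1 - r) * L + e / 2" if r: "0 < r" "r < 1" for r
    proof -
      have sg: "summable (\<lambda>n. r ^ n * (e / 2))"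
        using r by (intro summable_mult2 summable_geometric) auto
      have fin: "(\<lambda>n. if n \<in> {..<N} then norm (R (n + 1)) else 0) sums L"
        unfolding L_def by (rule sums_If_finite_set) simp
      have "norm (\<Sum>n. r ^ n *\<^sub>R R (n + 1)) \<le> (\<Sum>n. norm (r ^ n *\<^sub>R R (n + 1)))"
        using summ[OF r, of 1] by (rule summable_norm)
      also have "\<dots> \<le> (\<Sum>n. (if n \<in> {..<N} then norm (R (n + 1)) else 0) + r ^ n * (e / 2))"
      proof (rule suminf_le)
        fix n
        have "r ^ n * norm (R (n + 1)) \<le> norm (R (n + 1))"
          using r by (simp add: mult_left_le_one_le power_le_one)
        moreover have "r ^ n * norm (R (n + 1)) \<le> r ^ n * (e / 2)" if "n \<ge> N"
          using N[of "n + 1"] r that by (intro mult_left_mono) auto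
        moreover have "0 \<le> r ^ n * (e / 2)" using r e by auto
        ultimately show "norm (r ^ n *\<^sub>R R (n + 1))
            \<le> (if n \<in> {..<N} then norm (R (n + 1)) else 0) + r ^ n * (e / 2)"
          using r by (auto simp: not_less intro: order_trans[OF _ add_increasing2])
      qed (use summ[OF r, of 1] summable_add[OF sums_summable[OF fin] sg] in auto)
      also have "\<dots> = L + (\<Sum>n. r ^ n) * (e / 2)"
        using suminf_add[OF sums_summable[OF fin] sg] fin r
          suminf_mult2[OF summable_geometric[of r], of "e / 2"]
        by (simp add: sums_iff)
      also have "(\<Sum>n. r ^ n) = 1 / (1 - r)"
        using r by (intro suminf_geometric) auto
      finally have "(1 - r) * norm (\<Sum>n. r ^ n *\<^sub>R R (n + 1)) \<le> (1 - r) * (L + 1 / (1 - r) * (e / 2))"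
        using r by (intro mult_left_mono) auto
      also have "\<dots> = (1 - r) * L + (1 - r) * (1 / (1 - r)) * (e / 2)"
        by (simp only: distrib_left mult.assoc)
      also have "(1 - r) * (1 / (1 - r)) = 1"
        using r by simp
      finally show ?thesis
        using r by (simp add: key)
    qed
    have "((\<lambda>r. (1 - r) * L + e / 2) \<longlongrightarrow> (1 - 1) * L + e / 2) (at_left (1::real))"
      by (intro tendsto_intros)
    then have "eventually (\<lambda>r. (1 - r) * L + e / 2 < e) (at_left (1::real))"
      by (rule order_tendstoD) (use e in simp)
    moreover have "eventually (\<lambda>r::real. 0 < r \<and> r < 1) (at_left 1)"
      using eventually_at_left_real[of 0 1] by (simp add: eventually_mono)
    ultimately show "eventually (\<lambda>r. dist (\<Sum>n. r ^ n *\<^sub>R b n) S < e) (at_left 1)"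
      by eventually_elim (use bound in \<open>fastforce simp: dist_norm\<close>)
  qed
qed

text \<open>
  The annulus is centred at \<open>1\<close>, the disc at \<open>0\<close>.  A point \<open>s\<close> is joined to \<open>0\<close> by the arc about
  \<open>1\<close> that runs from \<open>s\<close> to the real axis, followed by a real segment.  Along both pieces the
  modulus never exceeds that of \<open>s\<close>; the distance from \<open>1\<close> is constant on the arc and tends
  monotonically to \<open>1\<close> on the segment.
\<close>

lemma connected_disc_Int_annulus:
  fixes \<alpha> \<beta> \<rho> :: real
  assumes "0 \<le> \<alpha>" "\<alpha> < 1" "1 < \<beta>"
  shows "connected {s::complex. norm s < \<rho> \<and> \<alpha> < norm (1 - s) \<and> norm (1 - s) < \<beta>}"
    (is "connected ?D")
proof -
  have "\<exists>K. connected K \<and> 0 \<in> K \<and> s \<in> K \<and> K \<subseteq> ?D" if s: "s \<in> ?D" for s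
  proof -
    define r where "r = norm (1 - s)"
    define \<theta> where "\<theta> = Arg (1 - s)"
    have r: "\<alpha> < r" "r < \<beta>" "0 < r"
      using s assms by (auto simp: r_def)
    have s_eq: "s = 1 - of_real r * cis \<theta>"
      using rcis_cmod_Arg[of "1 - s"] by (simp add: r_def \<theta>_def rcis_def)
    have norm_arc: "(norm (1 - of_real r * cis \<phi>))\<^sup>2 = 1 - 2 * r * cos \<phi> + r\<^sup>2" for \<phi>
    proof -
      have "(norm (1 - of_real r * cis \<phi>))\<^sup>2 = (1 - r * cos \<phi>)\<^sup>2 + (r * sin \<phi>)\<^sup>2"
        by (simp add: cmod_power2)
      also have "\<dots> = 1 - 2 * r * cos \<phi> + r\<^sup>2 * ((cos \<phi>)\<^sup>2 + (sin \<phi>)\<^sup>2)"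
        unfolding power2_diff power_mult_distrib distrib_left by simp
      finally show ?thesis by simp
    qed
    have arc_norm: "norm (1 - of_real r * cis (\<tau> * \<theta>)) \<le> norm s" if "0 \<le> \<tau>" "\<tau> \<le> 1" for \<tau>
    proof -
      have "cos \<bar>\<theta>\<bar> \<le> cos \<bar>\<tau> * \<theta>\<bar>"
      proof (rule cos_monotone_0_pi_le)
        show "\<bar>\<tau> * \<theta>\<bar> \<le> \<bar>\<theta>\<bar>"
          using that by (simp add: abs_mult mult_left_le_one_le)
        show "\<bar>\<theta>\<bar> \<le> pi"
          using Arg_bounded[of "1 - s"] by (auto simp: \<theta>_def)
      qed simp
      then have "r * cos \<theta> \<le> r * cos (\<tau> * \<theta>)"
        using r by (intro mult_left_mono) auto
      then have "(norm (1 - of_real r * cis (\<tau> * \<theta>)))\<^sup>2 \<le> (norm (1 - of_real r * cis \<theta>))\<^sup>2"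
        by (simp only: norm_arc)
      then have "norm (1 - of_real r * cis (\<tau> * \<theta>)) \<le> norm (1 - of_real r * cis \<theta>)"
        by (rule power2_le_imp_le) simp
      then show ?thesis
        using arg_cong[OF s_eq, of norm] by linarith
    qed
    define K where "K = (\<lambda>\<tau>. 1 - of_real r * cis (\<tau> * \<theta>)) ` {0..1} \<union> closed_segment 0 (of_real (1 - r))"
    have "connected K"
      unfolding K_def
    proof (rule connected_Un)
      show "connected ((\<lambda>\<tau>. 1 - of_real r * cis (\<tau> * \<theta>)) ` {0..1})"
        by (intro connected_continuous_image continuous_intros) auto
      have "1 - of_real r * cis (0 * \<theta>) \<in> (\<lambda>\<tau>. 1 - of_real r * cis (\<tau> * \<theta>)) ` {0..1}"
        by (rule imageI) simp
      moreover have "1 - of_real r * cis (0 * \<theta>) \<in> closed_segment 0 (of_real (1 - r))"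
        by simp
      ultimately show "(\<lambda>\<tau>. 1 - of_real r * cis (\<tau> * \<theta>)) ` {0..1}
          \<inter> closed_segment 0 (of_real (1 - r)) \<noteq> {}"
        by blast
    qed simp
    moreover have "0 \<in> K"
      by (simp add: K_def)
    moreover have "s \<in> K"
      unfolding K_def by (rule UnI1, rule image_eqI[of _ _ 1]) (simp_all flip: s_eq)
    moreover have "K \<subseteq> ?D"
    proof
      fix z assume "z \<in> K"
      then consider (arc) \<tau> where "0 \<le> \<tau>" "\<tau> \<le> 1" "z = 1 - of_real r * cis (\<tau> * \<theta>)"
        | (seg) u where "0 \<le> u" "u \<le> 1" "z = of_real (u * (1 - r))"
        by (auto simp: K_def closed_segment_def scaleR_conv_of_real)
      then show "z \<in> ?D"
      proof cases
        case arc
        then have "norm (1 - z) = r" using r by (simp add: norm_mult)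
        with arc show ?thesis
          using arc_norm[of \<tau>] r s by auto
      next
        case seg
        have "norm z = u * \<bar>1 - r\<bar>"
          using seg by (simp add: abs_mult norm_mult del: of_real_mult of_real_diff)
        also have "\<dots> \<le> \<bar>1 - r\<bar>"
          using seg by (simp add: mult_left_le_one_le)
        also have "\<dots> = norm (1 - of_real r * cis (0 * \<theta>))"
          using norm_of_real[of "1 - r", where ?'a = complex] by simp
        also have "\<dots> \<le> norm s"
          using arc_norm[of 0] by simp
        finally have 1: "norm z < \<rho>" using s by simp
        have 3: "1 - z = of_real ((1 - u) * 1 + u * r)"
          using seg by (simp add: algebra_simps)
        have 2: "norm (1 - z) = (1 - u) * 1 + u * r"
          unfolding 3 norm_of_real using seg r by simp
        have "convex {\<alpha><..<\<beta>}" by simp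
        then have "(1 - u) *\<^sub>R 1 + u *\<^sub>R r \<in> {\<alpha><..<\<beta>}"
          by (rule convexD) (use seg r assms in auto)
        with 1 2 show ?thesis by simp
      qed
    qed
    ultimately show ?thesis by blast
  qed
  then have "\<forall>s\<in>?D. connected_component ?D 0 s"
    unfolding connected_component_def by blast
  then show ?thesis
    unfolding connected_iff_connected_component
    by (meson connected_component_sym connected_component_trans)
qed

text \<open>
  Continuation of a germ at \<open>0\<close> to a point \<open>t\<close> that may lie on the circle of convergence of its Taylor
  series.  The domain is the part of the unit disc inside an annulus about \<open>1\<close>, since that is where
  the functions of interest are known to be holomorphic; it need not contain the segment from
  \<open>0\<close> to \<open>t\<close>.
\<close>

lemma powser_continuation:
  fixes f :: "complex \<Rightarrow> complex" and a :: "nat \<Rightarrow> complex"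
  assumes \<alpha>\<beta>: "0 \<le> \<alpha>" "\<alpha> < 1" "1 < \<beta>"
    and holo: "f holomorphic_on {s. norm s < 1 \<and> \<alpha> < norm (1 - s) \<and> norm (1 - s) < \<beta>}"
    and \<epsilon>: "0 < \<epsilon>" "\<And>s. norm s < \<epsilon> \<Longrightarrow> (\<lambda>n. a n * s ^ n) sums f s"
    and t: "norm t < 1" "\<alpha> < norm (1 - t)" "norm (1 - t) < \<beta>"
  shows powser_continuation_sums: "summable (\<lambda>n. a n * t ^ n) \<Longrightarrow> (\<lambda>n. a n * t ^ n) sums f t"
    and powser_continuation_summable:
      "\<alpha> < 1 - norm t \<Longrightarrow> 1 + norm t < \<beta> \<Longrightarrow> summable (\<lambda>n. a n * t ^ n)"
proof -
  define D where "D = (\<lambda>\<rho>. {s::complex. norm s < \<rho> \<and> \<alpha> < norm (1 - s) \<and> norm (1 - s) < \<beta>})"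
  have open_D: "open (D \<rho>)" for \<rho>
    unfolding D_def by (intro open_Collect_conj open_Collect_less continuous_intros)
  show "(\<lambda>n. a n * t ^ n) sums f t" if summ: "summable (\<lambda>n. a n * t ^ n)"
  proof (cases "t = 0")
    case True
    then show ?thesis using \<epsilon>(2)[of 0] \<epsilon>(1) by simp
  next
    case False
    define g where "g = (\<lambda>s. \<Sum>n. a n * s ^ n)"
    have rad: "ereal (norm t) \<le> conv_radius a"
      using conv_radius_geI[OF summ] .
    have g_holo: "g holomorphic_on D (norm t)"
    proof -
      have "eval_fps (Abs_fps a) holomorphic_on D (norm t)"
      proof (intro holomorphic_intros)
        have "ereal (norm z) < conv_radius a" if "norm z < norm t" for z :: complex
          using that by (intro less_le_trans[OF _ rad]) simp
        then show "D (norm t) \<subseteq> eball 0 (fps_conv_radius (Abs_fps a))"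
          by (auto simp: D_def fps_conv_radius_def)
      qed
      then show ?thesis by (simp add: eval_fps_def[abs_def] g_def)
    qed
    have fg: "f s = g s" if "s \<in> D (norm t)" for s
    proof (rule analytic_continuation_open[where f = f and g = g and s = "D (min \<epsilon> (norm t))"
          and s' = "D (norm t)" and z = s])
      have "0 \<in> D (min \<epsilon> (norm t))"
        using \<alpha>\<beta> \<epsilon> False by (simp add: D_def)
      then show "D (min \<epsilon> (norm t)) \<noteq> {}" by blast
      show "connected (D (norm t))"
        unfolding D_def using \<alpha>\<beta> by (rule connected_disc_Int_annulus)
      show "D (min \<epsilon> (norm t)) \<subseteq> D (norm t)"
        by (auto simp: D_def)
      show "f holomorphic_on D (norm t)"
        using holo by (rule holomorphic_on_subset) (use t in \<open>auto simp: D_def\<close>)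
      show "f z = g z" if "z \<in> D (min \<epsilon> (norm t))" for z
        using \<epsilon>(2)[of z] that by (simp add: D_def g_def sums_iff)
    qed (use open_D g_holo that in auto)
    have "t \<in> D 1"
      using t by (simp add: D_def)
    moreover have "isCont f t"
      using holomorphic_on_imp_differentiable_at[of f "D 1" t] holo open_D[of 1] \<open>t \<in> D 1\<close>
      by (auto simp: D_def intro: field_differentiable_imp_continuous_at)
    moreover have lim_t: "((\<lambda>r. of_real r * t) \<longlongrightarrow> of_real 1 * t) (at_left 1)"
      by (intro tendsto_intros)
    ultimately have f_lim: "((\<lambda>r. f (of_real r * t)) \<longlongrightarrow> f t) (at_left 1)"
      using isCont_tendsto_compose by fastforce
    have "eventually (\<lambda>r. of_real r * t \<in> D 1) (at_left 1)"
      using topological_tendstoD[OF lim_t open_D, of 1] \<open>t \<in> D 1\<close> by simp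
    moreover have "eventually (\<lambda>r::real. 0 < r \<and> r < 1) (at_left 1)"
      using eventually_at_left_real[of 0 1] by (simp add: eventually_mono)
    ultimately have "eventually (\<lambda>r. f (of_real r * t) = (\<Sum>n. r ^ n *\<^sub>R (a n * t ^ n))) (at_left 1)"
    proof eventually_elim
      case (elim r)
      then have "of_real r * t \<in> D (norm t)"
        using False by (auto simp: D_def norm_mult)
      then show ?case
        by (simp add: fg g_def scaleR_conv_of_real power_mult_distrib mult_ac)
    qed
    \<comment> \<open>Close to \<open>t\<close> the radius to \<open>t\<close> runs inside the annulus, so \<open>f\<close> and the power series agree on it.\<close>
    then have "((\<lambda>r. \<Sum>n. r ^ n *\<^sub>R (a n * t ^ n)) \<longlongrightarrow> f t) (at_left 1)"
      using f_lim by (rule Lim_transform_eventually[rotated])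
    then have "f t = (\<Sum>n. a n * t ^ n)"
      using Abel_limit[OF summable_sums[OF summ]] tendsto_unique trivial_limit_at_left_real by blast
    then show ?thesis using summ by (simp add: sums_iff)
  qed
  show "summable (\<lambda>n. a n * t ^ n)" if disc: "\<alpha> < 1 - norm t" "1 + norm t < \<beta>"
  proof -
    \<comment> \<open>The radius of the largest disc about \<open>0\<close> inside the annulus and the unit disc.\<close>
    define \<rho> where "\<rho> = min 1 (min (1 - \<alpha>) (\<beta> - 1))"
    have \<rho>: "norm t < \<rho>"
      using disc t by (auto simp: \<rho>_def)
    have "eball 0 (ereal \<rho>) \<subseteq> D 1"
    proof
      fix s :: complex assume "s \<in> eball 0 (ereal \<rho>)"
      then have "norm s < \<rho>" by (simp add: in_eball_iff)
      moreover have "1 - norm s \<le> norm (1 - s)" "norm (1 - s) \<le> 1 + norm s"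
        using norm_triangle_ineq2[of 1 s] norm_triangle_ineq4[of 1 s] by auto
      ultimately show "s \<in> D 1" by (auto simp: D_def \<rho>_def)
    qed
    then have holo': "f holomorphic_on eball 0 (ereal \<rho>)"
      using holo unfolding D_def by (rule holomorphic_on_subset[rotated])
    have "eventually (\<lambda>s. (\<lambda>n. a n * s ^ n) sums f s) (nhds 0)"
      using eventually_nhds_in_open[of "ball 0 \<epsilon>" 0] \<epsilon> by (auto elim!: eventually_mono)
    then have "f has_fps_expansion Abs_fps a"
      by (intro has_fps_expansionI) simp
    then have "fps_expansion f 0 = Abs_fps a"
      by (rule fps_expansion_eqI)
    then have "ereal \<rho> \<le> conv_radius a"
      using conv_radius_fps_expansion[OF holo'] by (simp add: fps_conv_radius_def)
    moreover have "ereal (norm t) < ereal \<rho>"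
      using \<rho> by simp
    ultimately have "ereal (norm t) < conv_radius a"
      by (rule less_le_trans[rotated])
    then show ?thesis
      by (rule summable_in_conv_radius)
  qed
qed

section \<open>Sums of integer powers of one minus a variable\<close>

lemma powi_le_endpoint_sum:
  fixes r \<alpha> \<beta> :: real
  assumes "0 < \<alpha>" "\<alpha> \<le> r" "r \<le> \<beta>"
  shows "r powi k \<le> \<alpha> powi k + \<beta> powi k"
proof (cases "0 \<le> k")
  case True
  then have "r powi k \<le> \<beta> powi k"
    using assms by (intro power_int_mono) auto
  then show ?thesis using assms by (simp add: add_increasing)
next
  case False
  then have "r powi k \<le> \<alpha> powi k"
    using assms by (intro power_int_antimono) auto
  then show ?thesis using assms by (simp add: add_increasing2)
qed

lemma binomial_series_powi:
  fixes s :: complex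
  assumes "norm s < 1"
  shows "(\<lambda>n. pochhammer (of_int k) n / fact n * s ^ n) sums ((1 - s) powi (- k))"
proof -
  have "(\<lambda>n. (of_int (- k) gchoose n) * (- s) ^ n) sums (1 + (- s)) powr (of_int (- k))"
    by (rule gen_binomial_complex) (use assms in simp)
  moreover have "(of_int (- k) gchoose n) * (- s) ^ n = pochhammer (of_int k) n / fact n * s ^ n" for n
    by (simp add: gbinomial_pochhammer power_minus[of s n])
  moreover have "(1 + (- s)) powr (of_int (- k)) = (1 - s) powi (- k)"
    using assms by (subst complex_powr_of_int) auto
  ultimately show ?thesis by simp
qed

lemma norm_pochhammer_le:
  fixes z :: "'a::{real_normed_div_algebra,comm_ring_1}"
  shows "norm (pochhammer z n) \<le> pochhammer (norm z) n"
proof (induction n)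
  case (Suc n)
  have "norm (z + of_nat n) \<le> norm z + of_nat n"
    using norm_triangle_ineq[of z "of_nat n"] by simp
  moreover have "0 \<le> pochhammer (norm z) n"
    using norm_ge_zero Suc by (rule order_trans)
  ultimately show ?case
    using Suc by (simp add: pochhammer_Suc norm_mult mult_mono)
qed simp

lemma binomial_series_powi_majorant:
  fixes s :: complex
  assumes "norm s \<le> \<rho>" "\<rho> < 1"
  shows "summable (\<lambda>n. norm (pochhammer (of_int k) n / fact n * s ^ n))"
    and "(\<Sum>n. norm (pochhammer (of_int k :: complex) n / fact n * s ^ n)) \<le> (1 - \<rho>) powi (- \<bar>k\<bar>)"
proof -
  define m where "m = \<bar>k\<bar>"
  have "0 \<le> \<rho>" using assms norm_ge_zero order_trans by blast
  have "complex_of_real (pochhammer (of_int m) n / fact n * \<rho> ^ n)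
      = pochhammer (of_int m) n / fact n * of_real \<rho> ^ n" for n
    by (simp flip: pochhammer_of_real)
  moreover have "complex_of_real ((1 - \<rho>) powi (- m)) = (1 - of_real \<rho>) powi (- m)"
    by simp
  ultimately have "(\<lambda>n. complex_of_real (pochhammer (of_int m) n / fact n * \<rho> ^ n)) sums
      complex_of_real ((1 - \<rho>) powi (- m))"
    using binomial_series_powi[of "of_real \<rho>" m] assms \<open>0 \<le> \<rho>\<close>
    by (simp only: norm_of_real abs_of_nonneg)
  then have major: "(\<lambda>n. pochhammer (of_int m) n / fact n * \<rho> ^ n) sums ((1 - \<rho>) powi (- m))"
    by (simp only: sums_of_real_iff)
  have le: "norm (pochhammer (of_int k :: complex) n / fact n * s ^ n)
      \<le> pochhammer (of_int m) n / fact n * \<rho> ^ n" for n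
  proof -
    have 1: "norm (pochhammer (of_int k :: complex) n) \<le> pochhammer (of_int m) n"
      using norm_pochhammer_le[of "of_int k :: complex" n] by (simp add: m_def)
    have 2: "norm s ^ n \<le> \<rho> ^ n"
      using assms by (intro power_mono) auto
    have "norm (pochhammer (of_int k :: complex) n) / fact n * norm s ^ n
        \<le> pochhammer (of_int m) n / fact n * \<rho> ^ n"
      using 1 2 order_trans[OF norm_ge_zero 1] by (intro mult_mono divide_right_mono) auto
    then show ?thesis
      by (simp add: norm_mult norm_divide norm_power)
  qed
  show summ: "summable (\<lambda>n. norm (pochhammer (of_int k) n / fact n * s ^ n))"
    by (rule summable_comparison_test'[OF sums_summable[OF major]]) (use le in simp)
  show "(\<Sum>n. norm (pochhammer (of_int k :: complex) n / fact n * s ^ n)) \<le> (1 - \<rho>) powi (- \<bar>k\<bar>)"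
    using suminf_le[OF le summ sums_summable[OF major]] major by (simp add: sums_iff m_def)
qed

text \<open>
  Summability at the two boundary radii yields a majorant on the whole annulus, to which the
  Weierstrass test applies.
\<close>

lemma holomorphic_on_powi_infsum:
  fixes u :: "'i \<Rightarrow> complex" and w :: "'i \<Rightarrow> int"
  assumes "0 < \<alpha>"
    and summ: "(\<lambda>i. norm (u i) * \<alpha> powi (- w i)) summable_on UNIV"
      "(\<lambda>i. norm (u i) * \<beta> powi (- w i)) summable_on UNIV"
  shows "(\<lambda>s. \<Sum>\<^sub>\<infinity>i. u i * (1 - s) powi (- w i)) holomorphic_on {s. \<alpha> < norm (1 - s) \<and> norm (1 - s) < \<beta>}"
    (is "_ holomorphic_on ?\<Omega>")
proof -
  have "open ?\<Omega>"
    by (intro open_Collect_conj open_Collect_less continuous_intros)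
  have ulim: "uniform_limit ?\<Omega> (\<lambda>X s. \<Sum>i\<in>X. u i * (1 - s) powi (- w i))
      (\<lambda>s. \<Sum>\<^sub>\<infinity>i. u i * (1 - s) powi (- w i)) (finite_subsets_at_top UNIV)"
  proof (rule Weierstrass_m_test_general)
    show "(\<lambda>i. norm (u i) * \<alpha> powi (- w i) + norm (u i) * \<beta> powi (- w i)) summable_on UNIV"
      using summ by (rule summable_on_add)
    fix i and s :: complex assume "s \<in> ?\<Omega>"
    then show "norm (u i * (1 - s) powi (- w i)) \<le> norm (u i) * \<alpha> powi (- w i) + norm (u i) * \<beta> powi (- w i)"
      using powi_le_endpoint_sum[of \<alpha> "norm (1 - s)" \<beta> "- w i"] \<open>0 < \<alpha>\<close>
      by (simp add: norm_mult norm_power_int mult_left_mono flip: distrib_left)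
  qed
  have term_holo: "(\<lambda>s. u i * (1 - s) powi (- w i)) holomorphic_on ?\<Omega>" for i
    using \<open>0 < \<alpha>\<close> by (intro holomorphic_intros) auto
  have "\<exists>f'. ((\<lambda>s. \<Sum>\<^sub>\<infinity>i. u i * (1 - s) powi (- w i)) has_field_derivative f') (at z)" if "z \<in> ?\<Omega>" for z
  proof -
    obtain r where r: "0 < r" "cball z r \<subseteq> ?\<Omega>"
      using \<open>open ?\<Omega>\<close> \<open>z \<in> ?\<Omega>\<close> open_contains_cball by blast
    have partial: "(\<lambda>s. \<Sum>i\<in>X. u i * (1 - s) powi (- w i)) holomorphic_on ?\<Omega>" for X
      by (intro holomorphic_intros term_holo)
    have "(\<lambda>s. \<Sum>\<^sub>\<infinity>i. u i * (1 - s) powi (- w i)) holomorphic_on ball z r"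
    proof (rule holomorphic_uniform_limit)
      show "\<forall>\<^sub>F X in finite_subsets_at_top UNIV.
          continuous_on (cball z r) (\<lambda>s. \<Sum>i\<in>X. u i * (1 - s) powi (- w i)) \<and>
          (\<lambda>s. \<Sum>i\<in>X. u i * (1 - s) powi (- w i)) holomorphic_on ball z r"
        using partial r ball_subset_cball[of z r]
        by (intro always_eventually allI conjI holomorphic_on_imp_continuous_on)
          (blast intro: holomorphic_on_subset)+
      show "uniform_limit (cball z r) (\<lambda>X s. \<Sum>i\<in>X. u i * (1 - s) powi (- w i))
          (\<lambda>s. \<Sum>\<^sub>\<infinity>i. u i * (1 - s) powi (- w i)) (finite_subsets_at_top UNIV)"
        using ulim r(2) by (rule uniform_limit_on_subset)
    qed auto
    then show ?thesis
      using \<open>0 < r\<close> by (auto simp: holomorphic_on_open)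
  qed
  with \<open>open ?\<Omega>\<close> show ?thesis
    by (simp add: holomorphic_on_open)
qed

text \<open>
  The Taylor expansion of a sum of powers of \<open>1 - s\<close> at \<open>s = 0\<close>.  The binomial series of one power is
  dominated on \<open>norm s \<le> \<rho>\<close> by \<open>(1 - \<rho>) powi (- \<bar>w\<bar>)\<close>, that is, by \<open>r powi (- w)\<close> for \<open>r = 1 - \<rho>\<close> or
  \<open>r = 1 / (1 - \<rho>)\<close>.  The bound on \<open>norm s\<close> places both values of \<open>r\<close> between \<open>\<alpha>\<close> and \<open>\<beta>\<close>, so the double
  series is absolutely summable and may be rearranged.
\<close>

lemma powi_infsum_expansion:
  fixes u :: "'i \<Rightarrow> complex" and w :: "'i \<Rightarrow> int"
  assumes "0 < \<alpha>" "\<alpha> < 1" "1 < \<beta>"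
    and summ: "(\<lambda>i. norm (u i) * \<alpha> powi (- w i)) summable_on UNIV"
      "(\<lambda>i. norm (u i) * \<beta> powi (- w i)) summable_on UNIV"
    and s: "norm s \<le> min (1 - \<alpha>) (1 - 1 / \<beta>)"
  defines "c \<equiv> \<lambda>n. \<Sum>\<^sub>\<infinity>i. pochhammer (of_int (w i)) n * u i"
  shows "s \<noteq> 0 \<Longrightarrow> (\<lambda>i. pochhammer (of_int (w i)) n * u i) summable_on UNIV"
    and "summable (\<lambda>n. norm (c n / fact n * s ^ n))"
    and "(\<lambda>n. c n / fact n * s ^ n) sums (\<Sum>\<^sub>\<infinity>i. u i * (1 - s) powi (- w i))"
proof -
  define \<rho> where "\<rho> = min (1 - \<alpha>) (1 - 1 / \<beta>)"
  have \<rho>: "\<alpha> \<le> 1 - \<rho>" "1 - \<rho> > 0" "inverse (1 - \<rho>) \<le> \<beta>" "\<rho> < 1" "0 < \<rho>"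
    using assms(1-3) by (auto simp: \<rho>_def min_def field_simps)
  define b where "b = (\<lambda>i n. pochhammer (of_int (w i)) n / fact n * s ^ n)"
  have b: "summable (\<lambda>n. norm (b i n))" "(\<Sum>n. norm (b i n)) \<le> (1 - \<rho>) powi (- \<bar>w i\<bar>)" for i
    using binomial_series_powi_majorant[of s \<rho> "w i"] s \<rho> by (auto simp: b_def \<rho>_def)
  have b_sums: "(b i has_sum (1 - s) powi (- w i)) UNIV" for i
  proof (rule norm_summable_imp_has_sum[OF b(1)])
    have "norm s \<le> \<rho>" using s by (simp only: \<rho>_def)
    then have "norm s < 1" using \<rho> by linarith
    then show "b i sums (1 - s) powi (- w i)"
      unfolding b_def by (rule binomial_series_powi)
  qed
  have le: "(1 - \<rho>) powi (- \<bar>w i\<bar>) \<le> \<alpha> powi (- w i) + \<beta> powi (- w i)" for i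
  proof (cases "w i \<ge> 0")
    case True
    then show ?thesis
      using powi_le_endpoint_sum[of \<alpha> "1 - \<rho>" \<beta> "- w i"] \<rho> assms(1-3) by simp
  next
    case False
    have "(1 - \<rho>) powi (- \<bar>w i\<bar>) = inverse (1 - \<rho>) powi (- w i)"
      using False by (simp add: power_int_minus power_int_inverse)
    also have "\<dots> \<le> \<alpha> powi (- w i) + \<beta> powi (- w i)"
    proof (rule powi_le_endpoint_sum)
      show "\<alpha> \<le> inverse (1 - \<rho>)"
        using \<rho> assms(1-3) one_le_inverse_iff[of "1 - \<rho>"] by linarith
    qed (use \<rho> assms in auto)
    finally show ?thesis .
  qed
  have "(\<lambda>p. norm (case p of (i, n) \<Rightarrow> u i * b i n)) summable_on (UNIV \<times> UNIV)"
    unfolding Infinite_Sum.abs_summable_on_Sigma_iff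
  proof (intro conjI ballI)
    fix i
    have "((\<lambda>n. norm (u i) * norm (b i n)) has_sum norm (u i) * (\<Sum>n. norm (b i n))) UNIV"
      using b(1)[of i] by (intro has_sum_cmult_right norm_summable_imp_has_sum) auto
    then show "(\<lambda>n. norm (case (i, n) of (i, n) \<Rightarrow> u i * b i n)) summable_on UNIV"
      by (auto simp: norm_mult summable_on_def)
  next
    have eq: "(\<Sum>\<^sub>\<infinity>n. norm (u i * b i n)) = norm (u i) * (\<Sum>n. norm (b i n))" for i
      using b(1)[of i] unfolding norm_mult
      by (intro infsumI has_sum_cmult_right norm_summable_imp_has_sum) auto
    have "(\<lambda>i. norm (u i) * \<alpha> powi (- w i) + norm (u i) * \<beta> powi (- w i)) summable_on UNIV"
      using summ by (rule summable_on_add)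
    then have "(\<lambda>i. norm (norm (u i) * (\<Sum>n. norm (b i n)))) summable_on UNIV"
    proof (rule Infinite_Sum.abs_summable_on_comparison_test')
      fix i
      show "norm (norm (u i) * (\<Sum>n. norm (b i n))) \<le> norm (u i) * \<alpha> powi (- w i) + norm (u i) * \<beta> powi (- w i)"
        using order_trans[OF b(2) le] b(1)
        by (simp add: mult_left_mono suminf_nonneg flip: distrib_left)
    qed
    then show "(\<lambda>i. norm (\<Sum>\<^sub>\<infinity>n. norm (case (i, n) of (i, n) \<Rightarrow> u i * b i n))) summable_on UNIV"
      by (simp add: eq)
  qed
  then have summ_in: "(\<lambda>(i, n). u i * b i n) summable_on (UNIV \<times> UNIV)"
    by (rule abs_summable_summable)
  then obtain S where S: "((\<lambda>(i, n). u i * b i n) has_sum S) (UNIV \<times> UNIV)"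
    by (auto simp: summable_on_def)
  have "((\<lambda>i. u i * (1 - s) powi (- w i)) has_sum S) UNIV"
    by (rule has_sum_SigmaD[OF S]) (use b_sums in \<open>auto intro: has_sum_cmult_right\<close>)
  then have S_eq: "S = (\<Sum>\<^sub>\<infinity>i. u i * (1 - s) powi (- w i))"
    by (simp add: infsumI)
  have S': "((\<lambda>(n, i). u i * b i n) has_sum S) (UNIV \<times> UNIV)"
    using S by (subst (asm) has_sum_swap) simp
  have summ_i: "(\<lambda>i. u i * b i n) summable_on UNIV" for n
    using summable_on_SigmaD1[of "\<lambda>n i. u i * b i n" UNIV "\<lambda>_. UNIV" n] S'
    by (auto simp: summable_on_def)
  show "(\<lambda>i. pochhammer (of_int (w i)) n * u i) summable_on UNIV" if "s \<noteq> 0"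
    using summable_on_cmult_right[OF summ_i[of n], of "fact n / s ^ n"] that
    by (simp add: b_def mult_ac)
  have c: "(\<Sum>\<^sub>\<infinity>i. u i * b i n) = c n / fact n * s ^ n" for n
  proof -
    have "(\<Sum>\<^sub>\<infinity>i. u i * b i n) = (\<Sum>\<^sub>\<infinity>i. pochhammer (of_int (w i)) n * u i * (s ^ n / fact n))"
      by (simp add: b_def mult_ac)
    also have "\<dots> = c n * (s ^ n / fact n)"
      unfolding c_def by (rule infsum_cmult_left')
    finally show ?thesis by simp
  qed
  have has: "((\<lambda>n. c n / fact n * s ^ n) has_sum S) UNIV"
  proof (rule has_sum_SigmaD[OF S'])
    show "((\<lambda>i. case (n, i) of (n, i) \<Rightarrow> u i * b i n) has_sum c n / fact n * s ^ n) UNIV" for n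
      using has_sum_infsum[OF summ_i[of n]] by (simp add: c)
  qed
  then show "(\<lambda>n. c n / fact n * s ^ n) sums (\<Sum>\<^sub>\<infinity>i. u i * (1 - s) powi (- w i))"
    unfolding S_eq by (rule has_sum_imp_sums)
  show "summable (\<lambda>n. norm (c n / fact n * s ^ n))"
    using has by (metis has_sum_imp_summable summable_on_iff_abs_summable_on_complex summable_on_imp_summable)
qed

section \<open>The matrix Pochhammer symbol\<close>

lemma mscale_nth [simp]: "(c *\<^sub>m M) $ i $ j = c * M $ i $ j"
  by (simp add: mscale_def)

lemma mscale_mscale [simp]: "c *\<^sub>m (d *\<^sub>m M) = (c * d) *\<^sub>m M"
  by (simp add: vec_eq_iff)

lemma mscale_add_right: "c *\<^sub>m (M + N) = c *\<^sub>m M + c *\<^sub>m N"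
  by (simp add: vec_eq_iff distrib_left)

lemma mscale_one [simp]: "1 *\<^sub>m M = M"
  by (simp add: vec_eq_iff)

lemma matrix_add_rdistrib: "(A + B) ** C = A ** C + B ** C"
  by (simp add: vec_eq_iff matrix_matrix_mult_def distrib_right sum.distrib)

lemma mscale_matrix_mult_left: "(c *\<^sub>m M) ** N = c *\<^sub>m (M ** N)"
  by (simp add: vec_eq_iff matrix_matrix_mult_def sum_distrib_left mult.assoc)

lemma mscale_matrix_mult_right: "M ** (c *\<^sub>m N) = c *\<^sub>m (M ** N)"
  by (simp add: vec_eq_iff matrix_matrix_mult_def sum_distrib_left mult_ac)

lemma mat_matrix_mult: "mat c ** M = c *\<^sub>m M"
  by (simp add: vec_eq_iff matrix_matrix_mult_def mat_def if_distrib[of "\<lambda>z. z * _"] cong: if_cong)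

lemma matrix_mult_mat: "M ** mat c = c *\<^sub>m M"
  by (simp add: vec_eq_iff matrix_matrix_mult_def mat_def if_distrib[of "\<lambda>z. _ * z"] mult.commute cong: if_cong)

lemma mat_add: "mat (a + b) = mat a + mat b" for a b :: "'a::monoid_add"
  by (simp add: vec_eq_iff mat_def)

lemma transpose_mscale: "transpose (c *\<^sub>m M) = c *\<^sub>m transpose M"
  by (simp add: vec_eq_iff transpose_def)

lemma transpose_add: "transpose (M + N) = transpose M + transpose N"
  by (simp add: vec_eq_iff transpose_def)

lemma norm_mscale: "norm (c *\<^sub>m M) = norm c * norm M"
proof -
  have row: "norm ((c *\<^sub>m M) $ i) = norm c * norm (M $ i)" for i
    by (simp add: norm_vec_def norm_mult L2_set_right_distrib)
  show ?thesis
    unfolding norm_vec_def[of "c *\<^sub>m M"] norm_vec_def[of M] row by (simp add: L2_set_right_distrib)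
qed

lemma norm_transpose: "norm (transpose M) = norm M" for M :: "complex^'d^'d"
proof -
  have eq: "(norm N)\<^sup>2 = (\<Sum>i\<in>UNIV. \<Sum>j\<in>UNIV. (norm (N $ i $ j))\<^sup>2)" for N :: "complex^'d^'d"
    by (simp add: norm_vec_def L2_set_def sum_nonneg)
  have "(norm (transpose M))\<^sup>2 = (norm M)\<^sup>2"
    unfolding eq by (simp add: transpose_def) (rule sum.swap)
  then show ?thesis by simp
qed

lemma norm_entry_le: "norm (M $ i $ j) \<le> norm (M :: complex^'d^'d)"
  using Finite_Cartesian_Product.norm_nth_le[of "M $ i" j] Finite_Cartesian_Product.norm_nth_le[of M i] by linarith

lemma bounded_bilinear_matrix_mult: "bounded_bilinear ((**) :: complex^'d^'d \<Rightarrow> _ \<Rightarrow> complex^'d^'d)"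
proof -
  have "(r *\<^sub>R M) ** N = r *\<^sub>R (M ** N)" "M ** (r *\<^sub>R N) = r *\<^sub>R (M ** N)"
    for r :: real and M N :: "complex^'d^'d"
    by (simp_all add: vec_eq_iff matrix_matrix_mult_def scaleR_right.sum)
  then show ?thesis
    by (simp add: bilinear_conv_bounded_bilinear[symmetric] bilinear_def linear_iff
        matrix_add_ldistrib matrix_add_rdistrib)
qed

lemmas bounded_linear_matrix_mult_left = bounded_bilinear.bounded_linear_left[OF bounded_bilinear_matrix_mult]
lemmas bounded_linear_matrix_mult_right = bounded_bilinear.bounded_linear_right[OF bounded_bilinear_matrix_mult]

lemma bounded_linear_mscale: "bounded_linear ((*\<^sub>m) c :: complex^'d^'d \<Rightarrow> _)"
  using bounded_linear_matrix_mult_right[of "mat c"] by (simp add: mat_matrix_mult)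

lemma bounded_linear_transpose: "bounded_linear (transpose :: complex^'d^'d \<Rightarrow> _)"
  by (simp add: linear_conv_bounded_linear[symmetric] linear_iff transpose_add transpose_scalar)

lemma has_sum_matrixI:
  fixes X :: "'i \<Rightarrow> complex^'d^'d"
  assumes "\<And>a b. ((\<lambda>i. X i $ a $ b) has_sum S $ a $ b) I"
  shows "(X has_sum S) I"
  using assms unfolding has_sum_def by (intro vec_tendstoI) (simp add: sum_component)

lemma sums_matrix_iff:
  fixes X :: "nat \<Rightarrow> complex^'d^'d"
  shows "X sums S \<longleftrightarrow> (\<forall>a b. (\<lambda>n. X n $ a $ b) sums (S $ a $ b))"
proof
  show "\<forall>a b. (\<lambda>n. X n $ a $ b) sums (S $ a $ b)" if "X sums S"
    using that by (auto intro: sums_vec_nth)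
  show "X sums S" if "\<forall>a b. (\<lambda>n. X n $ a $ b) sums (S $ a $ b)"
    using that unfolding sums_def by (intro vec_tendstoI) (simp add: sum_component)
qed

lemma mpoch_commute:
  assumes "M ** X = X ** M"
  shows "mpoch M n ** X = X ** mpoch M n"
proof (induction n)
  case (Suc n)
  have "(M + mat (of_nat n)) ** X = X ** (M + mat (of_nat n))"
    using assms by (simp add: matrix_add_ldistrib matrix_add_rdistrib mat_matrix_mult matrix_mult_mat)
  then show ?case
    using Suc by (metis matrix_mul_assoc mpoch.simps(2))
qed simp

lemma mpoch_commute_shift: "mpoch (M + mat c) m ** mpoch (M + mat d) n = mpoch (M + mat d) n ** mpoch (M + mat c) m"
proof -
  have "(M + mat c) ** (M + mat d) = (M + mat d) ** (M + mat c)"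
    by (simp add: matrix_add_ldistrib matrix_add_rdistrib mat_matrix_mult matrix_mult_mat
        mscale_add_right add_ac) (simp add: vec_eq_iff mat_def)
  from mpoch_commute[OF mpoch_commute[OF this, symmetric]] show ?thesis
    by (rule sym)
qed

lemma mpoch_add: "mpoch M (m + n) = mpoch M m ** mpoch (M + mat (of_nat m)) n"
proof (induction n)
  case (Suc n)
  then show ?case
    by (simp add: matrix_mul_assoc mat_add add.assoc)
qed simp

lemma mpoch_transpose: "mpoch (transpose M) n = transpose (mpoch M n)"
proof (induction n)
  case (Suc n)
  have "mpoch M n ** (M + mat (of_nat n)) = (M + mat (of_nat n)) ** mpoch M n"
    by (rule mpoch_commute) (simp add: matrix_add_ldistrib matrix_add_rdistrib mat_matrix_mult matrix_mult_mat)
  then show ?case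
    using Suc by (simp add: matrix_transpose_mul transpose_add)
qed simp

lemma invertible_mpoch:
  assumes "\<And>k. k < n \<Longrightarrow> invertible (M + mat (of_nat k))"
  shows "invertible (mpoch M n)"
  using assms
proof (induction n)
  case 0
  show ?case by (auto simp: invertible_def intro: exI[of _ "mat 1"])
next
  case (Suc n)
  then show ?case by (simp add: invertible_mult)
qed

lemma matrix_inv_eqs:
  assumes "invertible M"
  shows "M ** matrix_inv M = mat 1" "matrix_inv M ** M = mat 1"
  using someI_ex[OF assms[unfolded invertible_def]] unfolding matrix_inv_def by blast+

text \<open>
  A matrix and a scalar multiple of the identity commute, so the Chu--Vandermonde identity holds for their
  Pochhammer symbols.  It says that the coefficients of \<open>(1 - s)\<close> to the power \<open>- P - w\<close> are the Cauchy product of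
  those of the powers \<open>- P\<close> and \<open>- w\<close>.
\<close>

lemma mpoch_Vandermonde:
  "mpoch (P + mat w) n = (\<Sum>j\<le>n. (of_nat (n choose j) * pochhammer w (n - j)) *\<^sub>m mpoch P j)"
proof (induction n)
  case (Suc n)
  define c where "c = (\<lambda>n j. of_nat (n choose j) * pochhammer w (n - j) :: complex)"
  have step: "(c n j *\<^sub>m mpoch P j) ** (P + mat w + mat (of_nat n)) =
      c n j *\<^sub>m mpoch P (Suc j) + (of_nat (n choose j) * pochhammer w (Suc n - j)) *\<^sub>m mpoch P j" if "j \<le> n" for j
  proof -
    \<comment> \<open>The first summand raises the index of \<open>mpoch P j\<close>, the second that of the scalar Pochhammer symbol.\<close>
    have "P + mat w + mat (of_nat n) = (P + mat (of_nat j)) + mat (w + of_nat (n - j))"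
      using that by (simp add: vec_eq_iff mat_def of_nat_diff)
    then show ?thesis
      using that
      by (simp add: matrix_add_ldistrib matrix_mult_mat mscale_matrix_mult_left c_def Suc_diff_le
          pochhammer_Suc mult_ac)
        (simp add: vec_eq_iff algebra_simps)
  qed
  have c0: "c (Suc n) 0 = of_nat (n choose 0) * pochhammer w (Suc n - 0)"
    by (simp add: c_def)
  have cS: "c (Suc n) (Suc j) = c n j + of_nat (n choose Suc j) * pochhammer w (Suc n - Suc j)" for j
    by (simp add: c_def algebra_simps)
  have "mpoch (P + mat w) (Suc n) = (\<Sum>j\<le>n. (c n j *\<^sub>m mpoch P j) ** (P + mat w + mat (of_nat n)))"
    using Suc by (simp add: c_def bounded_bilinear.sum_left[OF bounded_bilinear_matrix_mult])
  also have "\<dots> = (\<Sum>j\<le>n. c n j *\<^sub>m mpoch P (Suc j))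
      + (\<Sum>j\<le>n. (of_nat (n choose j) * pochhammer w (Suc n - j)) *\<^sub>m mpoch P j)"
    unfolding sum.distrib[symmetric] by (intro sum.cong refl step) simp
  also have "(\<Sum>j\<le>n. (of_nat (n choose j) * pochhammer w (Suc n - j)) *\<^sub>m mpoch P j)
      = (\<Sum>j\<le>Suc n. (of_nat (n choose j) * pochhammer w (Suc n - j)) *\<^sub>m mpoch P j)"
    by (simp add: vec_eq_iff)
  also have "\<dots> = (of_nat (n choose 0) * pochhammer w (Suc n - 0)) *\<^sub>m mpoch P 0
      + (\<Sum>j\<le>n. (of_nat (n choose Suc j) * pochhammer w (Suc n - Suc j)) *\<^sub>m mpoch P (Suc j))"
    by (rule sum.atMost_Suc_shift)
  also have "(\<Sum>j\<le>n. c n j *\<^sub>m mpoch P (Suc j)) + \<dots> =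
      c (Suc n) 0 *\<^sub>m mpoch P 0 + (\<Sum>j\<le>n. c (Suc n) (Suc j) *\<^sub>m mpoch P (Suc j))"
    unfolding c0 cS by (simp add: vec_eq_iff sum.distrib sum_component distrib_right del: mpoch.simps)
  also have "\<dots> = (\<Sum>j\<le>Suc n. c (Suc n) j *\<^sub>m mpoch P j)"
    by (rule sum.atMost_Suc_shift[symmetric])
  finally show ?case by (simp only: c_def)
qed (simp add: vec_eq_iff)

text \<open>
  Boundedness of the bilinear product gives a constant \<open>K\<close> with \<open>norm (X ** Y) \<le> norm X * norm Y * K\<close>.  Each step of
  the recursion multiplies by \<open>M\<close> plus a scalar, and only the part \<open>M\<close> costs a factor \<open>K\<close>; hence \<open>norm (mpoch M n)\<close> is at most a
  constant times \<open>pochhammer (norm M * K) n\<close>, and a scalar binomial series is a majorant.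
\<close>

lemma summable_norm_mpoch_series:
  fixes M :: "complex^'d^'d"
  assumes "norm s < 1"
  shows "summable (\<lambda>n. norm ((s ^ n / fact n) *\<^sub>m mpoch M n))"
proof -
  obtain K where K: "0 < K" "\<And>(X :: complex^'d^'d) (Y :: complex^'d^'d). norm (X ** Y) \<le> norm X * norm Y * K"
    using bounded_bilinear.pos_bounded[OF bounded_bilinear_matrix_mult] by metis
  define q where "q = norm M * K"
  have "0 \<le> q" using K by (simp add: q_def)
  have bound: "norm (mpoch M n) \<le> norm (mat 1 :: complex^'d^'d) * pochhammer q n" for n
  proof (induction n)
    case (Suc n)
    have "norm (mpoch M (Suc n)) = norm (mpoch M n ** M + of_nat n *\<^sub>m mpoch M n)"
      by (simp add: matrix_add_ldistrib matrix_mult_mat)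
    also have "\<dots> \<le> norm (mpoch M n ** M) + norm (of_nat n *\<^sub>m mpoch M n)"
      by (rule norm_triangle_ineq)
    also have "\<dots> \<le> norm (mpoch M n) * (q + of_nat n)"
      using K(2)[of "mpoch M n" M] by (simp add: norm_mscale q_def algebra_simps)
    also have "\<dots> \<le> (norm (mat 1 :: complex^'d^'d) * pochhammer q n) * (q + of_nat n)"
      using Suc \<open>0 \<le> q\<close> by (intro mult_right_mono) auto
    finally show ?case by (simp add: pochhammer_Suc mult.assoc)
  qed simp
  have "(\<lambda>n. ((- q) gchoose n) * (- norm s) ^ n) sums (1 + - norm s) powr (- q)"
    using assms by (intro gen_binomial_real) simp
  moreover have "((- q) gchoose n) * (- norm s) ^ n = pochhammer q n / fact n * norm s ^ n" for n
    by (simp add: gbinomial_pochhammer power_minus[of "norm s"])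
  ultimately have "summable (\<lambda>n. norm (mat 1 :: complex^'d^'d) * (pochhammer q n / fact n * norm s ^ n))"
    by (intro summable_mult) (simp add: sums_iff)
  then show ?thesis
  proof (rule summable_comparison_test')
    fix n
    have "norm s ^ n / fact n * norm (mpoch M n)
        \<le> norm s ^ n / fact n * (norm (mat 1 :: complex^'d^'d) * pochhammer q n)"
      by (intro mult_left_mono bound) auto
    then show "norm (norm ((s ^ n / fact n) *\<^sub>m mpoch M n))
        \<le> norm (mat 1 :: complex^'d^'d) * (pochhammer q n / fact n * norm s ^ n)"
      by (simp add: norm_mscale norm_divide norm_power mult_ac)
  qed
qed

lemma matrix_sub_rdistrib: "(A - B) ** C = A ** C - B ** C" for A B C :: "complex^'d^'d"
  by (rule bounded_bilinear.diff_left[OF bounded_bilinear_matrix_mult])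

lemma matrix_sub_ldistrib: "A ** (B - C) = A ** B - A ** C" for A B C :: "complex^'d^'d"
  by (rule bounded_bilinear.diff_right[OF bounded_bilinear_matrix_mult])

lemma invertibleI:
  assumes "M ** N = mat 1" "N ** M = mat 1"
  shows "invertible M"
  using assms unfolding invertible_def by blast

lemma inverse_commute:
  fixes M N X :: "complex^'d^'d"
  assumes "N ** M = mat 1" "M ** N = mat 1" "M ** X = X ** M"
  shows "N ** X = X ** N"
proof -
  have "N ** X = N ** (X ** M) ** N"
    using assms(2) by (simp flip: matrix_mul_assoc)
  also have "\<dots> = N ** M ** X ** N"
    by (simp add: assms(3)[symmetric] matrix_mul_assoc)
  finally show ?thesis
    using assms(1) by simp
qed

text \<open>
  Reversing the order of the factors turns the Pochhammer symbol in the definition of \<^const>\<open>mpoch_int\<close> at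
  negative indices into one that ends just below \<open>M\<close>, for which the addition rule \<open>mpoch_add\<close> is available.
\<close>

lemma mpoch_reflect: "((-1) ^ q) *\<^sub>m mpoch (mat 1 - M) q = mpoch (M - mat (of_nat q)) q"
proof (induction q)
  case (Suc q)
  have fac: "mat 1 - M + mat (of_nat q) = (-1) *\<^sub>m (M - mat (of_nat (Suc q)))"
    by (simp add: vec_eq_iff mat_def)
  have comm: "mpoch (mat 1 - M) q ** (M - mat (of_nat (Suc q))) = (M - mat (of_nat (Suc q))) ** mpoch (mat 1 - M) q"
  proof (rule mpoch_commute)
    have "mat 1 - M = (-1) *\<^sub>m (M - mat (of_nat (Suc q))) + mat (- of_nat q)"
      by (simp add: vec_eq_iff mat_def)
    then show "(mat 1 - M) ** (M - mat (of_nat (Suc q))) = (M - mat (of_nat (Suc q))) ** (mat 1 - M)"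
      by (simp only: matrix_add_ldistrib matrix_add_rdistrib mat_matrix_mult matrix_mult_mat
          mscale_matrix_mult_left mscale_matrix_mult_right)
  qed
  have shift: "M - mat (of_nat (Suc q)) + mat (of_nat 1) = M - mat (of_nat q)"
    by (simp add: vec_eq_iff mat_def)
  have "((-1) ^ Suc q) *\<^sub>m mpoch (mat 1 - M) (Suc q) =
      (M - mat (of_nat (Suc q))) ** (((-1) ^ q) *\<^sub>m mpoch (mat 1 - M) q)"
    unfolding mpoch.simps fac mscale_matrix_mult_right mscale_mscale comm by simp
  also have "\<dots> = mpoch (M - mat (of_nat (Suc q))) 1 ** mpoch (M - mat (of_nat (Suc q)) + mat (of_nat 1)) q"
    unfolding Suc shift by simp
  also have "\<dots> = mpoch (M - mat (of_nat (Suc q))) (1 + q)"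
    by (rule mpoch_add[symmetric])
  finally show ?case by simp
qed simp

lemma mpoch_int_neg_inverse:
  fixes M :: "complex^'d^'d"
  assumes "\<And>k::nat. k \<ge> 1 \<Longrightarrow> invertible (M - mat (of_nat k))"
  shows "mpoch (M - mat (of_nat q)) q ** mpoch_int M (- int q) = mat 1"
    and "mpoch_int M (- int q) ** mpoch (M - mat (of_nat q)) q = mat 1"
proof -
  define c :: complex where "c = (-1) ^ q"
  have c: "c * c = 1"
    by (simp add: c_def flip: power_mult_distrib)
  define X where "X = mpoch (mat 1 - M) q"
  have Y: "mpoch (M - mat (of_nat q)) q = c *\<^sub>m X"
    unfolding c_def X_def by (rule mpoch_reflect[symmetric])
  have "invertible (mpoch (M - mat (of_nat q)) q)"
  proof (rule invertible_mpoch)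
    fix k assume "k < q"
    then have eq: "M - mat (of_nat q) + mat (of_nat k) = M - mat (of_nat (q - k))"
      by (simp add: vec_eq_iff mat_def of_nat_diff)
    show "invertible (M - mat (of_nat q) + mat (of_nat k))"
      unfolding eq by (rule assms) (use \<open>k < q\<close> in simp)
  qed
  note inv = matrix_inv_eqs[OF this, unfolded Y]
  have "invertible X"
    using inv by (intro invertibleI[of X "c *\<^sub>m matrix_inv (c *\<^sub>m X)"])
      (simp_all add: mscale_matrix_mult_left mscale_matrix_mult_right)
  note X = matrix_inv_eqs[OF this]
  have J: "mpoch_int M (- int q) = c *\<^sub>m matrix_inv X"
  proof (cases "q = 0")
    case True
    then show ?thesis
      using X by (simp add: mpoch_int_def X_def c_def)
  next
    case False
    then show ?thesis
      by (simp add: mpoch_int_def X_def c_def)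
  qed
  show "mpoch (M - mat (of_nat q)) q ** mpoch_int M (- int q) = mat 1"
    and "mpoch_int M (- int q) ** mpoch (M - mat (of_nat q)) q = mat 1"
    unfolding Y J using X c by (simp_all add: mscale_matrix_mult_left mscale_matrix_mult_right)
qed

lemma mpoch_int_commute:
  fixes M X :: "complex^'d^'d"
  assumes inv: "\<And>k::nat. k \<ge> 1 \<Longrightarrow> invertible (M - mat (of_nat k))"
    and comm: "M ** X = X ** M"
  shows "mpoch_int M p ** X = X ** mpoch_int M p"
proof (cases p rule: int_cases2)
  case (nonneg n)
  then show ?thesis using mpoch_commute[OF comm] by (simp add: mpoch_int_def)
next
  case (nonpos q)
  have "(M - mat (of_nat q)) ** X = X ** (M - mat (of_nat q))"
    using comm by (simp add: matrix_mult_mat mat_matrix_mult matrix_sub_ldistrib matrix_sub_rdistrib)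
  from mpoch_commute[OF this, of q] show ?thesis
    unfolding nonpos
    by (intro inverse_commute[of "mpoch_int M (- int q)" "mpoch (M - mat (of_nat q)) q"]
        mpoch_int_neg_inverse inv)
qed

lemma mpoch_swap: "mpoch M n ** mpoch (M + mat (of_nat n)) m = mpoch M m ** mpoch (M + mat (of_nat m)) n"
  using mpoch_add[of M n m] mpoch_add[of M m n] by (simp only: add.commute[of m n])

text \<open>
  Both sides stand for \<open>(A)\<close> with index \<open>n + p\<close>.  For negative \<open>p\<close> this is read off from the two ways of
  splitting a Pochhammer symbol that starts at \<open>A + p I\<close>, after multiplication with the inverses.
\<close>

lemma mpoch_int_swap:
  fixes A :: "complex^'d^'d"
  assumes neg: "\<And>k::nat. k \<ge> 1 \<Longrightarrow> invertible (A - mat (of_nat k))"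
    and pos: "\<And>k::nat. invertible (A + mat (of_nat k))"
  shows "mpoch A n ** mpoch_int (A + mat (of_nat n)) p = mpoch (A + mat (of_int p)) n ** mpoch_int A p"
proof (cases p rule: int_cases2)
  case (nonneg m)
  show ?thesis
    unfolding nonneg using mpoch_swap[of A n m] mpoch_commute_shift[of A 0 m "of_nat m" n]
    by (simp add: mpoch_int_def)
next
  case (nonpos q)
  define J where "J = mpoch_int A (- int q)"
  define J' where "J' = mpoch_int (A + mat (of_nat n)) (- int q)"
  define Y where "Y = mpoch (A - mat (of_nat q)) q"
  define Y' where "Y' = mpoch (A + mat (of_nat n) - mat (of_nat q)) q"
  have J: "J ** Y = mat 1" "Y ** J = mat 1"
    using mpoch_int_neg_inverse[OF neg] by (simp_all add: J_def Y_def)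
  have "invertible (A + mat (of_nat n) - mat (of_nat k))" for k
  proof (cases "k \<le> n")
    case True
    then have eq: "A + mat (of_nat n) - mat (of_nat k) = A + mat (of_nat (n - k))"
      by (simp add: vec_eq_iff mat_def of_nat_diff)
    show ?thesis unfolding eq by (rule pos)
  next
    case False
    then have eq: "A + mat (of_nat n) - mat (of_nat k) = A - mat (of_nat (k - n))"
      by (simp add: vec_eq_iff mat_def of_nat_diff)
    show ?thesis unfolding eq by (rule neg) (use False in simp)
  qed
  then have J': "Y' ** J' = mat 1"
    using mpoch_int_neg_inverse(1)[of "A + mat (of_nat n)" q] by (simp add: J'_def Y'_def)
  have "Y ** mpoch A n = mpoch (A - mat (of_nat q)) n ** Y'"
    using mpoch_swap[of "A - mat (of_nat q)" q n] by (simp add: Y_def Y'_def diff_add_eq)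
  then have "J ** (Y ** mpoch A n) ** J' = J ** (mpoch (A - mat (of_nat q)) n ** Y') ** J'"
    by simp
  moreover have "J ** (Y ** mpoch A n) ** J' = mpoch A n ** J'"
    using J by (simp add: matrix_mul_assoc)
  moreover have "J ** (mpoch (A - mat (of_nat q)) n ** Y') ** J' = J ** mpoch (A - mat (of_nat q)) n"
    using J' by (simp flip: matrix_mul_assoc)
  moreover have "J ** mpoch (A - mat (of_nat q)) n = mpoch (A - mat (of_nat q)) n ** J"
    unfolding J_def using neg
  proof (rule mpoch_int_commute)
    show "A ** mpoch (A - mat (of_nat q)) n = mpoch (A - mat (of_nat q)) n ** A"
      by (rule mpoch_commute[symmetric])
        (simp add: matrix_mult_mat mat_matrix_mult matrix_sub_ldistrib matrix_sub_rdistrib)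
  qed
  moreover have "A + mat (of_int p) = A - mat (of_nat q)"
    by (simp add: nonpos vec_eq_iff mat_def)
  ultimately show ?thesis
    by (simp add: nonpos J_def J'_def)
qed

section \<open>Binomial sums with matrix exponents\<close>

lemma has_sum_sum:
  fixes f :: "'j \<Rightarrow> 'i \<Rightarrow> 'b::topological_comm_monoid_add"
  assumes "finite J" "\<And>j. j \<in> J \<Longrightarrow> (f j has_sum S j) I"
  shows "((\<lambda>i. \<Sum>j\<in>J. f j i) has_sum (\<Sum>j\<in>J. S j)) I"
  using assms by (induction J rule: finite_induct) (auto intro: has_sum_add)

lemma holomorphic_one_minus_powr:
  "(\<lambda>s. one_minus_powr s M $ a $ b) holomorphic_on ball 0 1"
  and one_minus_powr_entry_sums:
  "norm s < 1 \<Longrightarrow> (\<lambda>n. mpoch M n $ a $ b / fact n * s ^ n) sums (one_minus_powr s M $ a $ b)"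
  and one_minus_powr_entry_summable:
  "norm s < 1 \<Longrightarrow> summable (\<lambda>n. norm (mpoch M n $ a $ b / fact n * s ^ n))"
proof -
  define e where "e = (\<lambda>n. mpoch M n $ a $ b / fact n)"
  have abs: "summable (\<lambda>n. norm (e n * s ^ n))" if "norm s < 1" for s
    using summable_norm_mpoch_series[OF that, of M]
  proof (rule summable_comparison_test')
    show "norm (norm (e n * s ^ n)) \<le> norm ((s ^ n / fact n) *\<^sub>m mpoch M n)" for n
      using norm_entry_le[of "(s ^ n / fact n) *\<^sub>m mpoch M n" a b] by (simp add: e_def mult.commute)
  qed
  have sums: "(\<lambda>n. e n * s ^ n) sums (one_minus_powr s M $ a $ b)" if "norm s < 1" for s
  proof -
    have "(\<lambda>n. (s ^ n / fact n) *\<^sub>m mpoch M n) sums one_minus_powr s M"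
      unfolding one_minus_powr_def
      by (intro summable_sums summable_norm_cancel[OF summable_norm_mpoch_series[OF that]])
    then show ?thesis
      by (simp add: sums_matrix_iff e_def mult.commute)
  qed
  have "1 \<le> conv_radius e"
    using conv_radius_geI_ex'[of 1 e] summable_norm_cancel[OF abs] by (simp add: one_ereal_def)
  then have "ereal (dist 0 z) < conv_radius e" if "dist 0 z < 1" for z :: complex
    using that by (auto simp: one_ereal_def intro: order.strict_trans2[of _ "ereal 1"])
  then have "ball (0::complex) 1 \<subseteq> eball 0 (fps_conv_radius (Abs_fps e))"
    by (auto simp: fps_conv_radius_def)
  then have "eval_fps (Abs_fps e) holomorphic_on ball 0 1"
    by (intro holomorphic_intros)
  moreover have "eval_fps (Abs_fps e) s = one_minus_powr s M $ a $ b" if "s \<in> ball 0 1" for s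
    using sums[of s] that by (simp add: eval_fps_def sums_iff)
  ultimately show "(\<lambda>s. one_minus_powr s M $ a $ b) holomorphic_on ball 0 1"
    by (rule holomorphic_transform)
  show "norm s < 1 \<Longrightarrow> (\<lambda>n. mpoch M n $ a $ b / fact n * s ^ n) sums (one_minus_powr s M $ a $ b)"
    and "norm s < 1 \<Longrightarrow> summable (\<lambda>n. norm (mpoch M n $ a $ b / fact n * s ^ n))"
    using sums abs by (simp_all add: e_def)
qed

text \<open>
  The analytic core, for an arbitrary family of matrices \<open>U i\<close> with integer weights \<open>w i\<close>: entry by entry,
  \<open>g n / n!\<close> are the Taylor coefficients at \<open>0\<close> of \<open>(1 - s)\<close> to the power \<open>- P\<close> times
  \<open>\<Sum>\<^sub>\<infinity>i. (1 - s) powi (- w i) *\<^sub>m U i\<close>.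
\<close>

lemma matrix_binomial_sum:
  fixes P :: "complex^'d^'d" and U :: "'i \<Rightarrow> complex^'d^'d" and w :: "'i \<Rightarrow> int"
  assumes \<alpha>\<beta>: "0 < \<alpha>" "\<alpha> < 1" "1 < \<beta>"
    and summ: "(\<lambda>i. norm (U i) * \<alpha> powi (- w i)) summable_on UNIV"
      "(\<lambda>i. norm (U i) * \<beta> powi (- w i)) summable_on UNIV"
    and t: "norm t < 1" "\<alpha> < norm (1 - t)" "norm (1 - t) < \<beta>"
  defines "g \<equiv> \<lambda>n. \<Sum>\<^sub>\<infinity>i. mpoch (P + mat (of_int (w i))) n ** U i"
  shows matrix_binomial_sums: "summable (\<lambda>n. (t ^ n / fact n) *\<^sub>m g n) \<Longrightarrow>
      (\<lambda>n. (t ^ n / fact n) *\<^sub>m g n) sums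
        (one_minus_powr t P ** (\<Sum>\<^sub>\<infinity>i. ((1 - t) powi (- w i)) *\<^sub>m U i))"
    and matrix_binomial_summable: "\<alpha> < 1 - norm t \<Longrightarrow> 1 + norm t < \<beta> \<Longrightarrow>
      summable (\<lambda>n. (t ^ n / fact n) *\<^sub>m g n)"
proof -
  define \<rho> where "\<rho> = min (1 - \<alpha>) (1 - 1 / \<beta>)"
  have \<rho>: "0 < \<rho>" "\<rho> < 1"
    using \<alpha>\<beta> by (auto simp: \<rho>_def min_def)
  define h where "h = (\<lambda>s c b. \<Sum>\<^sub>\<infinity>i. U i $ c $ b * (1 - s) powi (- w i))"
  define k where "k = (\<lambda>n c b. \<Sum>\<^sub>\<infinity>i. pochhammer (of_int (w i)) n * U i $ c $ b)"
  have summ_entry: "(\<lambda>i. norm (U i $ c $ b) * r powi (- w i)) summable_on UNIV"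
    if "(\<lambda>i. norm (U i) * r powi (- w i)) summable_on UNIV" "0 < r" for r c b
    by (rule summable_on_comparison_test[OF that(1)])
       (use that(2) in \<open>auto intro: mult_right_mono norm_entry_le\<close>)
  note summ' = summ_entry[OF summ(1) \<alpha>\<beta>(1)] summ_entry[OF summ(2) order.strict_trans[OF zero_less_one \<alpha>\<beta>(3)]]
  have expansion: "s \<noteq> 0 \<Longrightarrow> (\<lambda>i. pochhammer (of_int (w i)) n * U i $ c $ b) summable_on UNIV"
    "summable (\<lambda>n. norm (k n c b / fact n * s ^ n))"
    "(\<lambda>n. k n c b / fact n * s ^ n) sums h s c b" if "norm s \<le> \<rho>" for s n c b
    using powi_infsum_expansion[where s = s, OF \<alpha>\<beta> summ'[where c = c and b = b]] that
    unfolding \<rho>_def k_def h_def by blast+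
  define C where "C = (\<lambda>n. \<chi> c b. k n c b)"
  have C: "((\<lambda>i. pochhammer (of_int (w i)) n *\<^sub>m U i) has_sum C n) UNIV" for n
  proof (rule has_sum_matrixI)
    fix c b
    show "((\<lambda>i. (pochhammer (of_int (w i)) n *\<^sub>m U i) $ c $ b) has_sum C n $ c $ b) UNIV"
      using expansion(1)[of "of_real \<rho>" n c b] \<rho> by (simp add: C_def k_def has_sum_infsum)
  qed
  \<comment> \<open>The Vandermonde identity expresses \<open>g n\<close> through the coefficients \<open>C j\<close> of the scalar powers.\<close>
  have g_has_sum: "((\<lambda>i. mpoch (P + mat (of_int (w i))) n ** U i) has_sum
      (\<Sum>j\<le>n. of_nat (n choose j) *\<^sub>m (mpoch P j ** C (n - j)))) UNIV" for n
  proof -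
    have "((\<lambda>i. \<Sum>j\<le>n. of_nat (n choose j) *\<^sub>m (mpoch P j ** (pochhammer (of_int (w i)) (n - j) *\<^sub>m U i))) has_sum
        (\<Sum>j\<le>n. of_nat (n choose j) *\<^sub>m (mpoch P j ** C (n - j)))) UNIV"
      by (intro has_sum_sum finite_atMost has_sum_bounded_linear[OF bounded_linear_mscale]
          has_sum_bounded_linear[OF bounded_linear_matrix_mult_right] C)
    moreover have "(\<Sum>j\<le>n. of_nat (n choose j) *\<^sub>m (mpoch P j ** (pochhammer (of_int (w i)) (n - j) *\<^sub>m U i)))
        = mpoch (P + mat (of_int (w i))) n ** U i" for i
      by (simp add: mpoch_Vandermonde bounded_bilinear.sum_left[OF bounded_bilinear_matrix_mult]
          mscale_matrix_mult_left mscale_matrix_mult_right)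
    ultimately show ?thesis by simp
  qed
  have g: "g n = (\<Sum>j\<le>n. of_nat (n choose j) *\<^sub>m (mpoch P j ** C (n - j)))" for n
    unfolding g_def by (rule infsumI[OF g_has_sum])
  define f where "f = (\<lambda>s a b. \<Sum>c\<in>UNIV. one_minus_powr s P $ a $ c * h s c b)"
  \<comment> \<open>The Cauchy product of the two Taylor series has the coefficients \<open>g n / n!\<close>.\<close>
  have f_sums: "(\<lambda>n. g n $ a $ b / fact n * s ^ n) sums f s a b" if s: "norm s < \<rho>" for s a b
  proof -
    have "(\<lambda>n. \<Sum>c\<in>UNIV. \<Sum>j\<le>n. (mpoch P j $ a $ c / fact j * s ^ j) * (k (n - j) c b / fact (n - j) * s ^ (n - j)))
        sums (\<Sum>c\<in>UNIV. one_minus_powr s P $ a $ c * h s c b)"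
    proof (rule sums_sum)
      fix c
      have "norm s < 1" using s \<rho> by simp
      then show "(\<lambda>n. \<Sum>j\<le>n. (mpoch P j $ a $ c / fact j * s ^ j) * (k (n - j) c b / fact (n - j) * s ^ (n - j)))
          sums (one_minus_powr s P $ a $ c * h s c b)"
        using Cauchy_product_sums[OF one_minus_powr_entry_summable[of s P a c] expansion(2)[of s c b]]
          sums_unique[OF one_minus_powr_entry_sums[of s P a c]] sums_unique[OF expansion(3)[of s c b]] s
        by simp
    qed
    moreover have "(\<Sum>c\<in>UNIV. \<Sum>j\<le>n. (mpoch P j $ a $ c / fact j * s ^ j) * (k (n - j) c b / fact (n - j) * s ^ (n - j)))
        = g n $ a $ b / fact n * s ^ n" for n
    proof -
      have "(\<Sum>c\<in>UNIV. \<Sum>j\<le>n. (mpoch P j $ a $ c / fact j * s ^ j) * (k (n - j) c b / fact (n - j) * s ^ (n - j)))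
          = (\<Sum>c\<in>UNIV. \<Sum>j\<le>n. of_nat (n choose j) * (mpoch P j $ a $ c * k (n - j) c b) / fact n * s ^ n)"
      proof (intro sum.cong refl)
        fix c j assume "j \<in> {..n}"
        then have "s ^ n = s ^ j * s ^ (n - j)"
          and "of_nat (n choose j) = (fact n / (fact j * fact (n - j)) :: complex)"
          by (auto simp: binomial_fact simp flip: power_add)
        then show "(mpoch P j $ a $ c / fact j * s ^ j) * (k (n - j) c b / fact (n - j) * s ^ (n - j))
            = of_nat (n choose j) * (mpoch P j $ a $ c * k (n - j) c b) / fact n * s ^ n"
          by simp
      qed
      also have "\<dots> = g n $ a $ b / fact n * s ^ n"
        unfolding g C_def
        by (simp add: sum_component matrix_matrix_mult_def sum_distrib_left sum_divide_distrib sum_distrib_right)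
           (rule sum.swap)
      finally show ?thesis .
    qed
    ultimately show ?thesis by (simp add: f_def)
  qed
  have f_holo: "(\<lambda>s. f s a b) holomorphic_on {s. norm s < 1 \<and> \<alpha> < norm (1 - s) \<and> norm (1 - s) < \<beta>}" for a b
    unfolding f_def h_def
  proof (intro holomorphic_intros)
    fix c
    show "(\<lambda>s. one_minus_powr s P $ a $ c) holomorphic_on {s. norm s < 1 \<and> \<alpha> < norm (1 - s) \<and> norm (1 - s) < \<beta>}"
      by (rule holomorphic_on_subset[OF holomorphic_one_minus_powr]) auto
    show "(\<lambda>s. \<Sum>\<^sub>\<infinity>i. U i $ c $ b * (1 - s) powi (- w i))
        holomorphic_on {s. norm s < 1 \<and> \<alpha> < norm (1 - s) \<and> norm (1 - s) < \<beta>}"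
      by (rule holomorphic_on_subset[OF holomorphic_on_powi_infsum[OF \<alpha>\<beta>(1) summ']]) auto
  qed
  have \<alpha>0: "0 \<le> \<alpha>" using \<alpha>\<beta> by simp
  have continuation:
    "summable (\<lambda>n. g n $ a $ b / fact n * t ^ n) \<Longrightarrow> (\<lambda>n. g n $ a $ b / fact n * t ^ n) sums f t a b"
    "\<alpha> < 1 - norm t \<Longrightarrow> 1 + norm t < \<beta> \<Longrightarrow> summable (\<lambda>n. g n $ a $ b / fact n * t ^ n)" for a b
    using powser_continuation[where f = "\<lambda>s. f s a b" and a = "\<lambda>n. g n $ a $ b / fact n",
        OF \<alpha>0 \<alpha>\<beta>(2,3) f_holo \<rho>(1) f_sums t] by blast+
  define H where "H = (\<Sum>\<^sub>\<infinity>i. ((1 - t) powi (- w i)) *\<^sub>m U i)"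
  have H: "H $ c $ b = h t c b" for c b
  proof -
    have "(\<lambda>i. norm (((1 - t) powi (- w i)) *\<^sub>m U i)) summable_on UNIV"
    proof (rule Infinite_Sum.abs_summable_on_comparison_test'[OF summable_on_add[OF summ]])
      fix i
      show "norm (((1 - t) powi (- w i)) *\<^sub>m U i) \<le> norm (U i) * \<alpha> powi (- w i) + norm (U i) * \<beta> powi (- w i)"
        using powi_le_endpoint_sum[of \<alpha> "norm (1 - t)" \<beta> "- w i"] t \<alpha>\<beta>
        by (simp add: norm_mscale norm_power_int mult.commute[of _ "norm (U i)"] mult_left_mono flip: distrib_left)
    qed
    then have "(\<lambda>i. ((1 - t) powi (- w i)) *\<^sub>m U i) summable_on UNIV"
      by (rule abs_summable_summable)
    then have has: "((\<lambda>i. ((1 - t) powi (- w i)) *\<^sub>m U i) has_sum H) UNIV"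
      unfolding H_def by (rule has_sum_infsum)
    have "((\<lambda>i. (((1 - t) powi (- w i)) *\<^sub>m U i) $ c $ b) has_sum H $ c $ b) UNIV"
      by (rule has_sum_bounded_linear[OF bounded_linear_vec_nth
            has_sum_bounded_linear[OF bounded_linear_vec_nth has]])
    then show ?thesis
      by (simp add: h_def infsumI mult.commute)
  qed
  have entry: "((t ^ n / fact n) *\<^sub>m g n) $ a $ b = g n $ a $ b / fact n * t ^ n" for n a b
    by simp
  show "(\<lambda>n. (t ^ n / fact n) *\<^sub>m g n) sums (one_minus_powr t P ** H)"
    if "summable (\<lambda>n. (t ^ n / fact n) *\<^sub>m g n)"
    unfolding sums_matrix_iff entry
  proof (intro allI)
    fix a b
    have "summable (\<lambda>n. g n $ a $ b / fact n * t ^ n)"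
      using summable_vec_nth[OF summable_vec_nth[OF that, of a], of b] by (simp only: entry)
    then have "(\<lambda>n. g n $ a $ b / fact n * t ^ n) sums f t a b"
      by (rule continuation(1))
    then show "(\<lambda>n. g n $ a $ b / fact n * t ^ n) sums ((one_minus_powr t P ** H) $ a $ b)"
      by (simp add: f_def matrix_matrix_mult_def H)
  qed
  show "summable (\<lambda>n. (t ^ n / fact n) *\<^sub>m g n)" if "\<alpha> < 1 - norm t" "1 + norm t < \<beta>"
  proof -
    have "(\<lambda>n. (t ^ n / fact n) *\<^sub>m g n) sums (\<chi> a b. \<Sum>n. g n $ a $ b / fact n * t ^ n)"
      unfolding sums_matrix_iff entry
      using continuation(2)[OF that] by (simp add: summable_sums)
    then show ?thesis by (rule sums_summable)
  qed
qed

section \<open>Double power series\<close>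

text \<open>
  The norms of the terms at \<open>(x * z powi a, y * z powi b)\<close> depend only on \<open>norm z\<close>.  Varying \<open>norm z\<close> with the argument
  of \<open>z\<close> fixed moves the point continuously, so it stays in the interior of the domain of
  absolute convergence for all nearby values of \<open>norm z\<close>.
\<close>

lemma interior_convergence_radii:
  fixes T :: "nat \<times> nat \<Rightarrow> complex^'d^'d" and x y z :: complex and a b :: int
  assumes "z \<noteq> 0"
    and "(x * z powi a, y * z powi b) \<in>
      interior {(x, y). (\<lambda>(m, k). norm ((x ^ m * y ^ k) *\<^sub>m T (m, k))) summable_on UNIV}"
      (is "_ \<in> interior ?Z")
  obtains \<delta> where "0 < \<delta>" "\<And>r. 0 < r \<Longrightarrow> \<bar>r - norm z\<bar> < \<delta> \<Longrightarrow>
    (\<lambda>(m, k). norm ((x ^ m * y ^ k) *\<^sub>m T (m, k)) * r powi (a * int m + b * int k)) summable_on UNIV"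
proof -
  define u where "u = z / of_real (norm z)"
  define \<phi> where "\<phi> = (\<lambda>r. (x * (of_real r * u) powi a, y * (of_real r * u) powi b))"
  have u: "norm u = 1" "u \<noteq> 0" "of_real (norm z) * u = z"
    using assms(1) by (auto simp: u_def norm_divide)
  have "continuous_on {0<..} \<phi>"
    unfolding \<phi>_def using u(2) by (intro continuous_intros) auto
  then have "open ({0<..} \<inter> \<phi> -` interior ?Z)"
    by (intro continuous_open_preimage) auto
  moreover have "norm z \<in> {0<..} \<inter> \<phi> -` interior ?Z"
    using assms u(3) by (simp add: \<phi>_def)
  ultimately obtain \<delta> where \<delta>: "0 < \<delta>" "ball (norm z) \<delta> \<subseteq> {0<..} \<inter> \<phi> -` interior ?Z"
    using open_contains_ball by blast
  have "(\<lambda>(m, k). norm ((x ^ m * y ^ k) *\<^sub>m T (m, k)) * r powi (a * int m + b * int k)) summable_on UNIV"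
    if r: "0 < r" "\<bar>r - norm z\<bar> < \<delta>" for r
  proof -
    have "r \<in> ball (norm z) \<delta>"
      using r by (simp add: dist_real_def abs_minus_commute)
    then have "\<phi> r \<in> interior ?Z"
      using \<delta>(2) by blast
    then have "\<phi> r \<in> ?Z"
      using interior_subset by (rule rev_subsetD)
    moreover have "norm (((x * (of_real r * u) powi a) ^ m * (y * (of_real r * u) powi b) ^ k) *\<^sub>m T (m, k))
        = norm ((x ^ m * y ^ k) *\<^sub>m T (m, k)) * r powi (a * int m + b * int k)" for m k
    proof -
      have "r powi (a * int m + b * int k) = (r powi a) ^ m * (r powi b) ^ k"
        using r by (simp add: power_int_add power_int_power')
      then show ?thesis
        using r u by (simp add: norm_mscale norm_mult norm_power norm_power_int power_mult_distrib)
    qed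
    ultimately show ?thesis
      by (simp add: \<phi>_def)
  qed
  with \<delta>(1) show thesis by (rule that)
qed

text \<open>
  The case of \<open>matrix_binomial_sum\<close> in which the family consists of the terms of a double power series and the
  weights are \<open>- (a m + b k)\<close>: the powers of \<open>1 - t\<close> then only rescale the two variables.
\<close>

lemma double_series_binomial_sum:
  fixes P :: "complex^'d^'d" and T :: "nat \<times> nat \<Rightarrow> complex^'d^'d" and x y t :: complex and a b :: int
  assumes Z_def: "Z = interior {(x, y). (\<lambda>(m, k). norm ((x ^ m * y ^ k) *\<^sub>m T (m, k))) summable_on UNIV}"
    and g_def: "g = (\<lambda>n. \<Sum>\<^sub>\<infinity>(m, k). mpoch (P + mat (of_int (- (a * int m + b * int k)))) n
      ** ((x ^ m * y ^ k) *\<^sub>m T (m, k)))"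
    and t: "norm t < 1"
    and in_Z: "(x, y) \<in> Z" "(x * (1 - t) powi a, y * (1 - t) powi b) \<in> Z"
  shows double_series_binomial_sums: "summable (\<lambda>n. (t ^ n / fact n) *\<^sub>m g n) \<Longrightarrow>
      (\<lambda>n. (t ^ n / fact n) *\<^sub>m g n) sums (one_minus_powr t P **
        (\<Sum>\<^sub>\<infinity>(m, k). ((x * (1 - t) powi a) ^ m * (y * (1 - t) powi b) ^ k) *\<^sub>m T (m, k)))"
    and double_series_binomial_summable:
      "\<forall>s. norm s \<le> norm t \<longrightarrow> (x * (1 - s) powi a, y * (1 - s) powi b) \<in> Z \<Longrightarrow>
        summable (\<lambda>n. (t ^ n / fact n) *\<^sub>m g n)"
proof -
  define w where "w = (\<lambda>(m, k). - (a * int m + b * int k))"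
  define U where "U = (\<lambda>(m, k). (x ^ m * y ^ k) *\<^sub>m T (m, k))"
  have g: "g = (\<lambda>n. \<Sum>\<^sub>\<infinity>p. mpoch (P + mat (of_int (w p))) n ** U p)"
    unfolding g_def w_def U_def by (intro ext infsum_cong) auto
  have t1: "1 - t \<noteq> 0" using t by auto
  have H: "(\<Sum>\<^sub>\<infinity>p. ((1 - t) powi (- w p)) *\<^sub>m U p) =
      (\<Sum>\<^sub>\<infinity>(m, k). ((x * (1 - t) powi a) ^ m * (y * (1 - t) powi b) ^ k) *\<^sub>m T (m, k))"
    using t1 by (intro infsum_cong)
      (auto simp: w_def U_def power_int_add power_int_power' power_mult_distrib mult_ac)
  have radii: "\<exists>\<alpha> \<beta>. 0 < \<alpha> \<and> \<alpha> < norm z \<and> norm z' < \<beta> \<and>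
      (\<lambda>p. norm (U p) * \<alpha> powi (- w p)) summable_on UNIV \<and> (\<lambda>p. norm (U p) * \<beta> powi (- w p)) summable_on UNIV"
    if z: "z \<noteq> 0" "(x * z powi a, y * z powi b) \<in> Z" and z': "z' \<noteq> 0" "(x * z' powi a, y * z' powi b) \<in> Z" for z z'
  proof -
    have eq: "(\<lambda>(m, k). norm ((x ^ m * y ^ k) *\<^sub>m T (m, k)) * r powi (a * int m + b * int k))
        = (\<lambda>p. norm (U p) * r powi (- w p))" for r
      by (auto simp: fun_eq_iff U_def w_def add.commute)
    obtain \<delta> where \<delta>: "0 < \<delta>" "\<And>r. 0 < r \<Longrightarrow> \<bar>r - norm z\<bar> < \<delta> \<Longrightarrow> (\<lambda>p. norm (U p) * r powi (- w p)) summable_on UNIV"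
      using interior_convergence_radii[OF z[unfolded Z_def]] unfolding eq by blast
    obtain \<delta>' where \<delta>': "0 < \<delta>'" "\<And>r. 0 < r \<Longrightarrow> \<bar>r - norm z'\<bar> < \<delta>' \<Longrightarrow> (\<lambda>p. norm (U p) * r powi (- w p)) summable_on UNIV"
      using interior_convergence_radii[OF z'[unfolded Z_def]] unfolding eq by blast
    define \<alpha> where "\<alpha> = max (norm z / 2) (norm z - \<delta> / 2)"
    have "0 < \<alpha>" "\<alpha> < norm z" "\<bar>\<alpha> - norm z\<bar> < \<delta>"
      using z(1) \<delta>(1) by (auto simp: \<alpha>_def max_def)
    moreover have "0 < norm z' + \<delta>' / 2" "\<bar>(norm z' + \<delta>' / 2) - norm z'\<bar> < \<delta>'" "norm z' < norm z' + \<delta>' / 2"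
      using \<delta>'(1) by (auto intro: add_nonneg_pos)
    ultimately show ?thesis using \<delta>(2) \<delta>'(2) by blast
  qed
  have one: "(x * 1 powi a, y * 1 powi b) \<in> Z"
    using in_Z(1) by simp
  \<comment> \<open>Radii around both \<open>1\<close> and \<open>norm (1 - t)\<close>, from the two points of the region.\<close>
  obtain \<alpha> \<beta> where \<alpha>\<beta>: "0 < \<alpha>" "\<alpha> < 1" "1 < \<beta>" "\<alpha> < norm (1 - t)" "norm (1 - t) < \<beta>"
      "(\<lambda>p. norm (U p) * \<alpha> powi (- w p)) summable_on UNIV" "(\<lambda>p. norm (U p) * \<beta> powi (- w p)) summable_on UNIV"
  proof (cases "norm (1 - t) \<le> 1")
    case True
    then show ?thesis
      using radii[OF t1 in_Z(2) one_neq_zero one] that by force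
  next
    case False
    then show ?thesis
      using radii[OF one_neq_zero one t1 in_Z(2)] that by force
  qed
  show "(\<lambda>n. (t ^ n / fact n) *\<^sub>m g n) sums (one_minus_powr t P **
        (\<Sum>\<^sub>\<infinity>(m, k). ((x * (1 - t) powi a) ^ m * (y * (1 - t) powi b) ^ k) *\<^sub>m T (m, k)))"
    if "summable (\<lambda>n. (t ^ n / fact n) *\<^sub>m g n)"
    using matrix_binomial_sums[OF \<alpha>\<beta>(1-3,6,7) t \<alpha>\<beta>(4,5), of P] that unfolding g H by blast
  show "summable (\<lambda>n. (t ^ n / fact n) *\<^sub>m g n)"
    if disc: "\<forall>s. norm s \<le> norm t \<longrightarrow> (x * (1 - s) powi a, y * (1 - s) powi b) \<in> Z"
  proof -
    have "1 - complex_of_real (norm t) = of_real (1 - norm t)"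
      "1 - (- complex_of_real (norm t)) = of_real (1 + norm t)" by simp_all
    then have norms: "norm (1 - complex_of_real (norm t)) = 1 - norm t"
      "norm (1 - (- complex_of_real (norm t))) = 1 + norm t"
      using t by (simp_all only: norm_of_real) auto
    have nz: "1 - complex_of_real (norm t) \<noteq> 0" "1 - (- complex_of_real (norm t)) \<noteq> 0"
    proof -
      show "1 - complex_of_real (norm t) \<noteq> 0"
        using norms(1) t by (metis diff_gt_0_iff_gt less_irrefl norm_zero)
      have "0 < norm (1 - (- complex_of_real (norm t)))"
        unfolding norms(2) by (simp add: add_pos_nonneg)
      then show "1 - (- complex_of_real (norm t)) \<noteq> 0"
        by (simp only: zero_less_norm_iff not_False_eq_True)
    qed
    \<comment> \<open>On the disc of radius \<open>norm t\<close>, \<open>norm (1 - s)\<close> is extremal at \<open>s = norm t\<close> and \<open>s = - norm t\<close>.\<close>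
    have "norm (complex_of_real (norm t)) \<le> norm t" "norm (- complex_of_real (norm t)) \<le> norm t"
      by simp_all
    note in_Z' = disc[rule_format, OF this(1)] disc[rule_format, OF this(2)]
    obtain \<alpha> \<beta> where \<alpha>\<beta>: "0 < \<alpha>" "\<alpha> < 1 - norm t" "1 + norm t < \<beta>"
      "(\<lambda>p. norm (U p) * \<alpha> powi (- w p)) summable_on UNIV" "(\<lambda>p. norm (U p) * \<beta> powi (- w p)) summable_on UNIV"
      using radii[OF nz(1) in_Z'(1) nz(2) in_Z'(2), unfolded norms] by blast
    have "\<alpha> < 1" "1 < \<beta>" "\<alpha> < norm (1 - t)" "norm (1 - t) < \<beta>"
      using \<alpha>\<beta>(2,3) norm_triangle_ineq2[of 1 t] norm_triangle_ineq4[of 1 t] norm_ge_zero[of t] by (auto simp del: norm_ge_zero)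
    from matrix_binomial_summable[OF \<alpha>\<beta>(1) this(1,2) \<alpha>\<beta>(4,5) t this(3,4) \<alpha>\<beta>(2,3), of P]
    show ?thesis unfolding g .
  qed
qed

section \<open>The Horn function and its parameter shifts\<close>

lemma H1_term_scale:
  "H1_term A B C C' x y (m, n) = (x ^ m * y ^ n) *\<^sub>m H1_term A B C C' 1 1 (m, n)"
  by (simp add: H1_term_def)

lemma H1_region_coeffs:
  "H1_region A B C C' = interior {(x, y).
    (\<lambda>(m, n). norm ((x ^ m * y ^ n) *\<^sub>m H1_term A B C C' 1 1 (m, n))) summable_on UNIV}"
proof -
  have "(\<lambda>p. norm (H1_term A B C C' x y p))
      = (\<lambda>(m, n). norm ((x ^ m * y ^ n) *\<^sub>m H1_term A B C C' 1 1 (m, n)))" for x y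
    by (auto simp: fun_eq_iff H1_term_scale[of A B C C' x y])
  then show ?thesis
    by (simp add: H1_region_def)
qed

lemma H1_coeffs: "H1 A B C C' x y = (\<Sum>\<^sub>\<infinity>(m, n). (x ^ m * y ^ n) *\<^sub>m H1_term A B C C' 1 1 (m, n))"
  unfolding H1_def by (intro infsum_cong) (auto simp: H1_term_scale[of A B C C' x y])

lemma H1_summable_on:
  assumes "(x, y) \<in> H1_region A B C C'"
  shows "H1_term A B C C' x y summable_on UNIV"
proof -
  have "(\<lambda>p. norm (H1_term A B C C' x y p)) summable_on UNIV"
    using assms interior_subset unfolding H1_region_def by blast
  then show ?thesis by (rule abs_summable_summable)
qed

lemma infsum_matrix_mult_left_invertible:
  fixes M :: "complex^'d^'d" and f :: "'i \<Rightarrow> complex^'d^'d"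
  assumes "invertible M"
  shows "(\<Sum>\<^sub>\<infinity>i\<in>I. M ** f i) = M ** infsum f I"
proof (rule infsum_bounded_linear_strong[where h = "(**) M" and f = f])
  show "(\<lambda>i. M ** f i) summable_on I \<longleftrightarrow> f summable_on I"
    by (rule summable_on_bounded_linear_iff[where h = "(**) M" and h' = "(**) (matrix_inv M)",
          OF bounded_linear_matrix_mult_right bounded_linear_matrix_mult_right])
      (simp add: matrix_mul_assoc matrix_inv_eqs[OF assms])
qed (rule bounded_linear_matrix_mult_right)

lemma infsum_matrix_mult_right_invertible:
  fixes M :: "complex^'d^'d" and f :: "'i \<Rightarrow> complex^'d^'d"
  assumes "invertible M"
  shows "(\<Sum>\<^sub>\<infinity>i\<in>I. f i ** M) = infsum f I ** M"
proof (rule infsum_bounded_linear_strong[where h = "\<lambda>X. X ** M" and f = f])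
  show "(\<lambda>i. f i ** M) summable_on I \<longleftrightarrow> f summable_on I"
    by (rule summable_on_bounded_linear_iff[where h = "\<lambda>X. X ** M" and h' = "\<lambda>X. X ** matrix_inv M",
          OF bounded_linear_matrix_mult_left bounded_linear_matrix_mult_left])
      (simp add: matrix_inv_eqs[OF assms] flip: matrix_mul_assoc)
qed (rule bounded_linear_matrix_mult_left)

lemma infsum_transpose:
  fixes f :: "'i \<Rightarrow> complex^'d^'d"
  shows "(\<Sum>\<^sub>\<infinity>i\<in>I. transpose (f i)) = transpose (infsum f I)"
proof (rule infsum_bounded_linear_strong[where h = transpose and f = f])
  show "(\<lambda>i. transpose (f i)) summable_on I \<longleftrightarrow> f summable_on I"
    by (rule summable_on_bounded_linear_iff[where h = transpose and h' = transpose,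
          OF bounded_linear_transpose bounded_linear_transpose]) simp
qed (rule bounded_linear_transpose)

lemma one_minus_powr_transpose:
  assumes "norm t < 1"
  shows "one_minus_powr t (transpose M) = transpose (one_minus_powr t M)"
  unfolding one_minus_powr_def mpoch_transpose transpose_mscale[symmetric]
  by (intro bounded_linear.suminf[OF bounded_linear_transpose, symmetric]
      summable_norm_cancel[OF summable_norm_mpoch_series[OF assms]])

lemma H1_binomial_sum:
  fixes P A B C C' :: "complex^'d^'d" and x y t :: complex and a b :: int
  assumes t: "norm t < 1"
    and region: "(x, y) \<in> H1_region A B C C'"
      "(x * (1 - t) powi a, y * (1 - t) powi b) \<in> H1_region A B C C'"
    and g: "\<And>n. g n = (\<Sum>\<^sub>\<infinity>(m, k).
      mpoch (P + mat (of_int (- (a * int m + b * int k)))) n ** H1_term A B C C' x y (m, k))"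
  shows "summable (\<lambda>n. (t ^ n / fact n) *\<^sub>m g n) \<Longrightarrow>
      one_minus_powr t P ** H1 A B C C' (x * (1 - t) powi a) (y * (1 - t) powi b)
        = (\<Sum>n. (t ^ n / fact n) *\<^sub>m g n)"
    and "(\<forall>s. norm s \<le> norm t \<longrightarrow> (x * (1 - s) powi a, y * (1 - s) powi b) \<in> H1_region A B C C') \<Longrightarrow>
      summable (\<lambda>n. (t ^ n / fact n) *\<^sub>m g n)"
proof -
  have g': "g = (\<lambda>n. \<Sum>\<^sub>\<infinity>(m, k). mpoch (P + mat (of_int (- (a * int m + b * int k)))) n
      ** ((x ^ m * y ^ k) *\<^sub>m H1_term A B C C' 1 1 (m, k)))"
    unfolding g[abs_def] H1_term_scale[of A B C C' x y] ..
  note main = double_series_binomial_sum[OF H1_region_coeffs g' t region]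
  show "one_minus_powr t P ** H1 A B C C' (x * (1 - t) powi a) (y * (1 - t) powi b)
        = (\<Sum>n. (t ^ n / fact n) *\<^sub>m g n)" if "summable (\<lambda>n. (t ^ n / fact n) *\<^sub>m g n)"
    unfolding H1_coeffs using main(1)[OF that] by (rule sums_unique)
  show "summable (\<lambda>n. (t ^ n / fact n) *\<^sub>m g n)"
    if "\<forall>s. norm s \<le> norm t \<longrightarrow> (x * (1 - s) powi a, y * (1 - s) powi b) \<in> H1_region A B C C'"
    using that by (rule main(2))
qed

text \<open>
  The same with the factors on the right.  Transposition reverses products, commutes with \<^const>\<open>mpoch\<close> and preserves
  norms, hence regions of convergence.
\<close>

lemma H1_binomial_sum_right:
  fixes P A B C C' :: "complex^'d^'d" and x y t :: complex and a b :: int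
  assumes t: "norm t < 1"
    and region: "(x, y) \<in> H1_region A B C C'"
      "(x * (1 - t) powi a, y * (1 - t) powi b) \<in> H1_region A B C C'"
    and g: "\<And>n. g n = (\<Sum>\<^sub>\<infinity>(m, k).
      H1_term A B C C' x y (m, k) ** mpoch (P + mat (of_int (- (a * int m + b * int k)))) n)"
  shows "summable (\<lambda>n. (t ^ n / fact n) *\<^sub>m g n) \<Longrightarrow>
      H1 A B C C' (x * (1 - t) powi a) (y * (1 - t) powi b) ** one_minus_powr t P
        = (\<Sum>n. (t ^ n / fact n) *\<^sub>m g n)"
    and "(\<forall>s. norm s \<le> norm t \<longrightarrow> (x * (1 - s) powi a, y * (1 - s) powi b) \<in> H1_region A B C C') \<Longrightarrow>
      summable (\<lambda>n. (t ^ n / fact n) *\<^sub>m g n)"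
proof -
  define T where "T = (\<lambda>p. transpose (H1_term A B C C' 1 1 p))"
  have Z: "H1_region A B C C' = interior {(x, y). (\<lambda>(m, k). norm ((x ^ m * y ^ k) *\<^sub>m T (m, k))) summable_on UNIV}"
    unfolding H1_region_coeffs T_def by (simp only: norm_transpose transpose_mscale[symmetric])
  have H: "(\<Sum>\<^sub>\<infinity>(m, k). (u ^ m * v ^ k) *\<^sub>m T (m, k)) = transpose (H1 A B C C' u v)" for u v
    unfolding H1_coeffs T_def infsum_transpose[symmetric]
    by (intro infsum_cong) (auto simp: transpose_mscale)
  have g': "(\<lambda>n. transpose (g n)) = (\<lambda>n. \<Sum>\<^sub>\<infinity>(m, k).
      mpoch (transpose P + mat (of_int (- (a * int m + b * int k)))) n ** ((x ^ m * y ^ k) *\<^sub>m T (m, k)))"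
  proof
    fix n
    have eq: "transpose P + mat c = transpose (P + mat c)" for c
      by (simp add: transpose_add)
    show "transpose (g n) = (\<Sum>\<^sub>\<infinity>(m, k).
      mpoch (transpose P + mat (of_int (- (a * int m + b * int k)))) n ** ((x ^ m * y ^ k) *\<^sub>m T (m, k)))"
      unfolding g infsum_transpose[symmetric]
      by (intro infsum_cong)
        (auto simp: eq mpoch_transpose T_def matrix_transpose_mul transpose_mscale H1_term_scale[of A B C C' x y]
          simp del: of_int_minus of_int_add of_int_mult of_int_diff)
  qed
  have series: "(\<lambda>n. (t ^ n / fact n) *\<^sub>m transpose (g n)) = (\<lambda>n. transpose ((t ^ n / fact n) *\<^sub>m g n))"
    by (simp add: transpose_mscale)
  note main = double_series_binomial_sum[OF Z g' t region,
      unfolded H series one_minus_powr_transpose[OF t] matrix_transpose_mul[symmetric]]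
  have summable_transpose: "summable f" if "summable (\<lambda>n. transpose (f n))" for f :: "nat \<Rightarrow> complex^'d^'d"
    using bounded_linear.summable[OF bounded_linear_transpose that] by simp
  show "H1 A B C C' (x * (1 - t) powi a) (y * (1 - t) powi b) ** one_minus_powr t P
        = (\<Sum>n. (t ^ n / fact n) *\<^sub>m g n)" if summ: "summable (\<lambda>n. (t ^ n / fact n) *\<^sub>m g n)"
  proof -
    have "(\<lambda>n. transpose (transpose ((t ^ n / fact n) *\<^sub>m g n))) sums
        transpose (transpose (H1 A B C C' (x * (1 - t) powi a) (y * (1 - t) powi b) ** one_minus_powr t P))"
      by (intro bounded_linear.sums[OF bounded_linear_transpose] main(1)
          bounded_linear.summable[OF bounded_linear_transpose summ])
    then show ?thesis by (simp add: sums_iff)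
  qed
  show "summable (\<lambda>n. (t ^ n / fact n) *\<^sub>m g n)"
    if "\<forall>s. norm s \<le> norm t \<longrightarrow> (x * (1 - s) powi a, y * (1 - s) powi b) \<in> H1_region A B C C'"
    by (rule summable_transpose[OF main(2)[OF that]])
qed

text \<open>
  Multiplication by the invertible matrix \<open>(A)\<^sub>n\<close> commutes with \<^const>\<open>infsum\<close>, convergent or not: the value of
  a divergent sum is \<open>0\<close>, and one side converges if and only if the other does.
\<close>

lemma mpoch_H1_shift_A:
  fixes A :: "complex^'d^'d"
  assumes "\<And>k::nat. k \<ge> 1 \<Longrightarrow> invertible (A - mat (of_nat k))"
    and pos: "\<And>k::nat. invertible (A + mat (of_nat k))"
  shows "mpoch A n ** H1 (A + mat (of_nat n)) B C C' x y =
    (\<Sum>\<^sub>\<infinity>(m, k). mpoch (A + mat (of_int (int m - int k))) n ** H1_term A B C C' x y (m, k))"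
proof -
  have "mpoch A n ** H1 (A + mat (of_nat n)) B C C' x y =
      (\<Sum>\<^sub>\<infinity>p. mpoch A n ** H1_term (A + mat (of_nat n)) B C C' x y p)"
    unfolding H1_def
    by (intro infsum_matrix_mult_left_invertible[symmetric] invertible_mpoch pos)
  also have "\<dots> = (\<Sum>\<^sub>\<infinity>(m, k). mpoch (A + mat (of_int (int m - int k))) n ** H1_term A B C C' x y (m, k))"
  proof (intro infsum_cong, clarify)
    fix m k :: nat
    show "mpoch A n ** H1_term (A + mat (of_nat n)) B C C' x y (m, k) =
        mpoch (A + mat (of_int (int m - int k))) n ** H1_term A B C C' x y (m, k)"
      using mpoch_int_swap[OF assms, of n "int m - int k"]
      by (simp add: H1_term_def mscale_matrix_mult_right matrix_mul_assoc del: of_int_diff)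
  qed
  finally show ?thesis .
qed

text \<open>
  Here \<open>(B)\<^sub>n\<close> may be singular, so it is moved into the sum by summability.  It passes
  the factor in \<open>A\<close> because \<open>A\<close> and \<open>B\<close> commute.
\<close>

lemma mpoch_H1_shift_B:
  fixes A B :: "complex^'d^'d"
  assumes neg: "\<And>k::nat. k \<ge> 1 \<Longrightarrow> invertible (A - mat (of_nat k))"
    and comm: "A ** B = B ** A"
    and region: "(x, y) \<in> H1_region A (B + mat (of_nat n)) C C'"
  shows "mpoch B n ** H1 A (B + mat (of_nat n)) C C' x y =
    (\<Sum>\<^sub>\<infinity>(m, k). mpoch (B + mat (of_nat (m + k))) n ** H1_term A B C C' x y (m, k))"
proof -
  have "mpoch B n ** H1 A (B + mat (of_nat n)) C C' x y =
      (\<Sum>\<^sub>\<infinity>p. mpoch B n ** H1_term A (B + mat (of_nat n)) C C' x y p)"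
    unfolding H1_def
    using has_sum_bounded_linear[OF bounded_linear_matrix_mult_right has_sum_infsum[OF H1_summable_on[OF region]]]
    by (rule infsumI[symmetric])
  also have "\<dots> = (\<Sum>\<^sub>\<infinity>(m, k). mpoch (B + mat (of_nat (m + k))) n ** H1_term A B C C' x y (m, k))"
  proof (intro infsum_cong, clarify)
    fix m k :: nat
    define J where "J = mpoch_int A (int m - int k)"
    have J: "mpoch (B + mat c) n ** J = J ** mpoch (B + mat c) n" for c
    proof -
      have "B ** A = A ** B" using comm by simp
      then have "(B + mat c) ** A = A ** (B + mat c)"
        by (simp add: matrix_add_ldistrib matrix_add_rdistrib mat_matrix_mult matrix_mult_mat)
      from mpoch_commute[OF this] show ?thesis
        unfolding J_def using mpoch_int_commute[OF neg] by metis
    qed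
    have J0: "mpoch B n ** J = J ** mpoch B n"
      using J[of 0] by simp
    have "mpoch B n ** J ** mpoch (B + mat (of_nat n)) (m + k) = J ** (mpoch B n ** mpoch (B + mat (of_nat n)) (m + k))"
      by (simp only: J0 matrix_mul_assoc)
    also have "\<dots> = J ** (mpoch (B + mat (of_nat (m + k))) n ** mpoch B (m + k))"
      using mpoch_swap[of B n "m + k"] mpoch_commute_shift[of B 0 "m + k" "of_nat (m + k)" n] by simp
    also have "\<dots> = mpoch (B + mat (of_nat (m + k))) n ** J ** mpoch B (m + k)"
      by (simp only: J matrix_mul_assoc)
    finally show "mpoch B n ** H1_term A (B + mat (of_nat n)) C C' x y (m, k) =
        mpoch (B + mat (of_nat (m + k))) n ** H1_term A B C C' x y (m, k)"
      by (simp add: H1_term_def J_def mscale_matrix_mult_right matrix_mul_assoc del: of_nat_add)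
  qed
  finally show ?thesis .
qed

text \<open>
  As \<open>C\<close> commutes with \<open>C'\<close>, the factor \<open>(C)\<^sub>n\<close> passes the inverse of \<open>(C')\<^sub>m\<close> from the right and reaches \<open>(C + n I)\<^sub>k\<close>.
\<close>

lemma H1_mpoch_shift_C:
  fixes C C' :: "complex^'d^'d"
  assumes inv: "\<And>k::nat. invertible (C + mat (of_nat k))"
    and inv': "\<And>k::nat. invertible (C' + mat (of_nat k))"
    and comm: "C ** C' = C' ** C"
  shows "H1 A B (C + mat (of_nat n)) C' x y ** mpoch C n =
    (\<Sum>\<^sub>\<infinity>(m, k). H1_term A B C C' x y (m, k) ** mpoch (C + mat (of_nat k)) n)"
proof -
  have "H1 A B (C + mat (of_nat n)) C' x y ** mpoch C n =
      (\<Sum>\<^sub>\<infinity>p. H1_term A B (C + mat (of_nat n)) C' x y p ** mpoch C n)"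
    unfolding H1_def
    by (intro infsum_matrix_mult_right_invertible[symmetric] invertible_mpoch inv)
  also have "\<dots> = (\<Sum>\<^sub>\<infinity>(m, k). H1_term A B C C' x y (m, k) ** mpoch (C + mat (of_nat k)) n)"
  proof (intro infsum_cong, clarify)
    fix m k :: nat
    define J where "J = matrix_inv (mpoch C' m)"
    have J: "J ** mpoch (C + mat c) n = mpoch (C + mat c) n ** J" for c
      unfolding J_def
    proof (rule inverse_commute[OF matrix_inv_eqs(2,1)])
      show "invertible (mpoch C' m)" "invertible (mpoch C' m)"
        by (intro invertible_mpoch inv')+
      have "(C + mat c) ** C' = C' ** (C + mat c)"
        using comm by (simp add: matrix_add_ldistrib matrix_add_rdistrib mat_matrix_mult matrix_mult_mat)
      from mpoch_commute[OF mpoch_commute[OF this, symmetric]]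
      show "mpoch C' m ** mpoch (C + mat c) n = mpoch (C + mat c) n ** mpoch C' m" .
    qed
    have J0: "J ** mpoch C n = mpoch C n ** J"
      using J[of 0] by simp
    have swap: "mpoch (C + mat (of_nat n)) k ** mpoch C n = mpoch C k ** mpoch (C + mat (of_nat k)) n"
      using mpoch_swap[of C n k] mpoch_commute_shift[of C 0 n "of_nat n" k] by simp
    have "mpoch (C + mat (of_nat n)) k ** J ** mpoch C n = mpoch C k ** J ** mpoch (C + mat (of_nat k)) n"
      by (simp only: J J0 swap matrix_mul_assoc[symmetric]) (simp only: swap J matrix_mul_assoc)
    then have "X ** mpoch (C + mat (of_nat n)) k ** J ** mpoch C n
        = X ** mpoch C k ** J ** mpoch (C + mat (of_nat k)) n" for X :: "complex^'d^'d"
      by (metis matrix_mul_assoc)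
    then show "H1_term A B (C + mat (of_nat n)) C' x y (m, k) ** mpoch C n =
        H1_term A B C C' x y (m, k) ** mpoch (C + mat (of_nat k)) n"
      by (simp add: H1_term_def J_def mscale_matrix_mult_left)
  qed
  finally show ?thesis .
qed


theorem theorem5p4:
  fixes A B C C' :: "complex^'d^'d" and x y t :: complex
  assumes A_inv: "\<And>k::nat. k \<ge> 1 \<Longrightarrow> invertible (A - mat (of_nat k))"
    and C_inv: "\<And>k::nat. invertible (C + mat (of_nat k))"
    and C'_inv: "\<And>k::nat. invertible (C' + mat (of_nat k))"
    and t: "norm t < 1"
  shows
    "((\<forall>k::nat. invertible (A + mat (of_nat k))) \<longrightarrow>
      (x, y) \<in> H1_region A B C C' \<longrightarrow>
      (x / (1 - t), y * (1 - t)) \<in> H1_region A B C C' \<longrightarrow>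
      (let lhs = one_minus_powr t A ** H1 A B C C' (x / (1 - t)) (y * (1 - t));
           rhs = (\<lambda>n. (t ^ n / fact n) *\<^sub>m (mpoch A n ** H1 (A + mat (of_nat n)) B C C' x y))
       in (summable rhs \<longrightarrow> lhs = (\<Sum>n. rhs n)) \<and>
          ((\<forall>s. norm s \<le> norm t \<longrightarrow> (x / (1 - s), y * (1 - s)) \<in> H1_region A B C C') \<longrightarrow>
             summable rhs)))
     \<and>
     (A ** B = B ** A \<longrightarrow>
      (\<forall>n::nat. (x, y) \<in> H1_region A (B + mat (of_nat n)) C C') \<longrightarrow>
      (x / (1 - t), y / (1 - t)) \<in> H1_region A B C C' \<longrightarrow>
      (let lhs = one_minus_powr t B ** H1 A B C C' (x / (1 - t)) (y / (1 - t));
           rhs = (\<lambda>n. (t ^ n / fact n) *\<^sub>m (mpoch B n ** H1 A (B + mat (of_nat n)) C C' x y))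
       in (summable rhs \<longrightarrow> lhs = (\<Sum>n. rhs n)) \<and>
          ((\<forall>s. norm s \<le> norm t \<longrightarrow> (x / (1 - s), y / (1 - s)) \<in> H1_region A B C C') \<longrightarrow>
             summable rhs)))
     \<and>
     (C ** C' = C' ** C \<longrightarrow>
      (x, y) \<in> H1_region A B C C' \<longrightarrow>
      (x, y / (1 - t)) \<in> H1_region A B C C' \<longrightarrow>
      (let lhs = H1 A B C C' x (y / (1 - t)) ** one_minus_powr t C;
           rhs = (\<lambda>n. (t ^ n / fact n) *\<^sub>m (H1 A B (C + mat (of_nat n)) C' x y ** mpoch C n))
       in (summable rhs \<longrightarrow> lhs = (\<Sum>n. rhs n)) \<and>
          ((\<forall>s. norm s \<le> norm t \<longrightarrow> (x, y / (1 - s)) \<in> H1_region A B C C') \<longrightarrow>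
             summable rhs)))"
proof (intro conjI impI)
  assume A_pos: "\<forall>k::nat. invertible (A + mat (of_nat k))"
    and region: "(x, y) \<in> H1_region A B C C'"
      "(x / (1 - t), y * (1 - t)) \<in> H1_region A B C C'"
  have arg: "u * z powi (- 1) = u / z" "u * z powi 1 = u * z" for u z :: complex
    by (simp_all add: power_int_minus divide_inverse)
  have region': "(x * (1 - t) powi (- 1), y * (1 - t) powi 1) \<in> H1_region A B C C'"
    unfolding arg by (rule region(2))
  \<comment> \<open>The weight is \<open>m - k\<close>, so \<open>a = - 1\<close> and \<open>b = 1\<close>.\<close>
  have g: "mpoch A n ** H1 (A + mat (of_nat n)) B C C' x y = (\<Sum>\<^sub>\<infinity>(m, k).
      mpoch (A + mat (of_int (- (- 1 * int m + 1 * int k)))) n ** H1_term A B C C' x y (m, k))" for n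
    using mpoch_H1_shift_A[OF A_inv, of n B C C' x y] A_pos by (simp add: add.commute)
  show "let lhs = one_minus_powr t A ** H1 A B C C' (x / (1 - t)) (y * (1 - t));
           rhs = (\<lambda>n. (t ^ n / fact n) *\<^sub>m (mpoch A n ** H1 (A + mat (of_nat n)) B C C' x y))
       in (summable rhs \<longrightarrow> lhs = (\<Sum>n. rhs n)) \<and>
          ((\<forall>s. norm s \<le> norm t \<longrightarrow> (x / (1 - s), y * (1 - s)) \<in> H1_region A B C C') \<longrightarrow>
             summable rhs)"
    using H1_binomial_sum[where a = "- 1" and b = 1, OF t region(1) region' g]
    unfolding arg Let_def by blast
next
  assume AB: "A ** B = B ** A"
    and region_B: "\<forall>n::nat. (x, y) \<in> H1_region A (B + mat (of_nat n)) C C'"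
    and region: "(x / (1 - t), y / (1 - t)) \<in> H1_region A B C C'"
  have region0: "(x, y) \<in> H1_region A B C C'"
    using region_B[rule_format, of 0] by simp
  have arg: "u * z powi (- 1) = u / z" for u z :: complex
    by (simp add: power_int_minus divide_inverse)
  have region': "(x * (1 - t) powi (- 1), y * (1 - t) powi (- 1)) \<in> H1_region A B C C'"
    unfolding arg by (rule region)
  \<comment> \<open>The weight is \<open>m + k\<close>, so \<open>a = b = - 1\<close>.\<close>
  have g: "mpoch B n ** H1 A (B + mat (of_nat n)) C C' x y = (\<Sum>\<^sub>\<infinity>(m, k).
      mpoch (B + mat (of_int (- (- 1 * int m + - 1 * int k)))) n ** H1_term A B C C' x y (m, k))" for n
    using mpoch_H1_shift_B[OF A_inv AB region_B[rule_format, of n]] by (simp add: add.commute)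
  show "let lhs = one_minus_powr t B ** H1 A B C C' (x / (1 - t)) (y / (1 - t));
           rhs = (\<lambda>n. (t ^ n / fact n) *\<^sub>m (mpoch B n ** H1 A (B + mat (of_nat n)) C C' x y))
       in (summable rhs \<longrightarrow> lhs = (\<Sum>n. rhs n)) \<and>
          ((\<forall>s. norm s \<le> norm t \<longrightarrow> (x / (1 - s), y / (1 - s)) \<in> H1_region A B C C') \<longrightarrow>
             summable rhs)"
    using H1_binomial_sum[where a = "- 1" and b = "- 1", OF t region0 region' g]
    unfolding arg Let_def by blast
next
  assume CC: "C ** C' = C' ** C"
    and region: "(x, y) \<in> H1_region A B C C'" "(x, y / (1 - t)) \<in> H1_region A B C C'"
  have arg: "u * z powi 0 = u" "u * z powi (- 1) = u / z" for u z :: complex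
    by (simp_all add: power_int_minus divide_inverse)
  \<comment> \<open>The weight is \<open>k\<close>, so \<open>a = 0\<close> and \<open>b = - 1\<close>.\<close>
  have g: "H1 A B (C + mat (of_nat n)) C' x y ** mpoch C n = (\<Sum>\<^sub>\<infinity>(m, k).
      H1_term A B C C' x y (m, k) ** mpoch (C + mat (of_int (- (0 * int m + - 1 * int k)))) n)" for n
    using H1_mpoch_shift_C[OF C_inv C'_inv CC] by simp
  have region': "(x * (1 - t) powi 0, y * (1 - t) powi (- 1)) \<in> H1_region A B C C'"
    unfolding arg by (rule region(2))
  show "let lhs = H1 A B C C' x (y / (1 - t)) ** one_minus_powr t C;
           rhs = (\<lambda>n. (t ^ n / fact n) *\<^sub>m (H1 A B (C + mat (of_nat n)) C' x y ** mpoch C n))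
       in (summable rhs \<longrightarrow> lhs = (\<Sum>n. rhs n)) \<and>
          ((\<forall>s. norm s \<le> norm t \<longrightarrow> (x, y / (1 - s)) \<in> H1_region A B C C') \<longrightarrow>
             summable rhs)"
    using H1_binomial_sum_right[where a = 0 and b = "- 1", OF t region(1) region' g]
    unfolding arg Let_def by blast
qed

end
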